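(* Let $G$ be a non-compact, compactly generated, totally disconnected, locally compact group, and let $H\le\mathbb{Q}^{+}$ be the image of its modular function. Let $$A=\Big\{\sum_{i=1}^k (p_i+q_i)\ \Big|\ k\ge 1,\ p_1,\dots,p_k,q_1,\dots,q_k \text{ positive integers},\ \Big\langle \tfrac{p_1}{q_1},\dots,\tfrac{p_k}{q_k}\Big\rangle = H\Big\}.$$ Then every Cayley–Abels graph of $G$ has degree at least $\min(A)$. In particular, if $H$ is cyclic, generated by $p/q$ with $p,q$ coprime positive integers, then every Cayley–Abels graph of $G$ has degree at least $p+q$, i.e. $\mathrm{md}(G)\ge p+q$.
   Context: A Cayley–Abels graph for a totally disconnected, locally compact group $G$ is a connected, locally finite simple graph with an action of $G$ by automorphisms that is vertex-transitive with compact open vertex stabilizers; $\mathrm{md}(G)$ is the minimal degree of such a graph. The modular function $\Delta\colon G\to\mathbb{R}^+$ is defined via a right-invariant Haar measure $\mu$ by $\mu(gA)=\Delta(g)\mu(A)$; its image is a subgroup of the multiplicative group $\mathbb{Q}^+$ of positive rationals. *)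

theory Defs
  imports "HOL-Analysis.Analysis" "HOL-Probability.Probability"
begin

text \<open>Topological groups are modelled by the type class topological_group_add:
  a (not necessarily commutative) group written additively, with jointly continuous
  group operation and continuous inversion. Group product g h is written g + h.\<close>

definition totally_disconnected_space :: "'a::topological_space itself \<Rightarrow> bool" where
  "totally_disconnected_space _ \<longleftrightarrow> (\<forall>x::'a. connected_component_set UNIV x = {x})"

definition locally_compact_type :: "'a::topological_space itself \<Rightarrow> bool" where
  "locally_compact_type _ \<longleftrightarrow>
     (\<forall>x::'a. \<exists>U K. open U \<and> compact K \<and> x \<in> U \<and> U \<subseteq> K)"

inductive_set subgroup_generated :: "'a::group_add set \<Rightarrow> 'a set" for S where
  sg_gen: "x \<in> S \<Longrightarrow> x \<in> subgroup_generated S"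
| sg_zero: "0 \<in> subgroup_generated S"
| sg_add: "x \<in> subgroup_generated S \<Longrightarrow> y \<in> subgroup_generated S \<Longrightarrow> x + y \<in> subgroup_generated S"
| sg_uminus: "x \<in> subgroup_generated S \<Longrightarrow> - x \<in> subgroup_generated S"

definition compactly_generated :: "'a::{topological_space,group_add} itself \<Rightarrow> bool" where
  "compactly_generated _ \<longleftrightarrow> (\<exists>K::'a set. compact K \<and> subgroup_generated K = UNIV)"

text \<open>Right-invariant Haar measure: a nonzero right-invariant Radon measure on the Borel sets
  (finite on compacts, positive on nonempty open sets, outer regular on Borel sets,
  inner regular on open sets).\<close>

definition right_haar :: "'a::{topological_group_add} measure \<Rightarrow> bool" where
  "right_haar M \<longleftrightarrow>
     sets M = sets borel \<and>
     (\<forall>A\<in>sets borel. \<forall>g. emeasure M ((\<lambda>x. x + g) ` A) = emeasure M A) \<and>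
     (\<forall>K. compact K \<longrightarrow> emeasure M K < \<infinity>) \<and>
     (\<forall>U. open U \<and> U \<noteq> {} \<longrightarrow> emeasure M U > 0) \<and>
     (\<forall>A\<in>sets borel. emeasure M A = (INF U\<in>{U. open U \<and> A \<subseteq> U}. emeasure M U)) \<and>
     (\<forall>U. open U \<longrightarrow> emeasure M U = (SUP K\<in>{K. compact K \<and> K \<subseteq> U}. emeasure M K))"

text \<open>Modular function: mu(gA) = Delta(g) mu(A) for a (fixed) right Haar measure mu.\<close>

definition modular_function :: "'a::{topological_group_add} \<Rightarrow> real" where
  "modular_function g = (THE r. r > 0 \<and>
     (\<forall>A\<in>sets borel. emeasure (SOME M. right_haar M) ((\<lambda>x. g + x) ` A)
                      = ennreal r * emeasure (SOME M. right_haar M) A))"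

text \<open>Subgroup of the multiplicative group of positive reals generated by a set.\<close>

inductive_set mult_subgroup_generated :: "real set \<Rightarrow> real set" for S where
  msg_gen: "x \<in> S \<Longrightarrow> x \<in> mult_subgroup_generated S"
| msg_one: "1 \<in> mult_subgroup_generated S"
| msg_mult: "x \<in> mult_subgroup_generated S \<Longrightarrow> y \<in> mult_subgroup_generated S \<Longrightarrow> x * y \<in> mult_subgroup_generated S"
| msg_inv: "x \<in> mult_subgroup_generated S \<Longrightarrow> inverse x \<in> mult_subgroup_generated S"

text \<open>Cayley--Abels graph for G (vertex set = the type 'v): simple, connected, locally finite
  graph with a G-action by automorphisms which is vertex-transitive with compact open
  vertex stabilizers.\<close>

definition cayley_abels_graph ::
  "('g::{topological_group_add} \<Rightarrow> 'v \<Rightarrow> 'v) \<Rightarrow> ('v \<Rightarrow> 'v \<Rightarrow> bool) \<Rightarrow> bool" where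
  "cayley_abels_graph act E \<longleftrightarrow>
     (\<forall>v. \<not> E v v) \<and> (\<forall>u v. E u v \<longrightarrow> E v u) \<and>
     (\<forall>u v. (u, v) \<in> {(x, y). E x y}\<^sup>*) \<and>
     (\<forall>v. finite {w. E v w}) \<and>
     (\<forall>v. act 0 v = v) \<and> (\<forall>g h v. act (g + h) v = act g (act h v)) \<and>
     (\<forall>g u v. E (act g u) (act g v) \<longleftrightarrow> E u v) \<and>
     (\<forall>u v. \<exists>g. act g u = v) \<and>
     (\<forall>v. compact {g. act g v = v} \<and> open {g. act g v = v})"

end

theory Submission
  imports Defs
begin

text \<open>
  Fix a vertex \<open>v\<close> with stabiliser \<open>V\<close>. For \<open>u = g v\<close> the numbers \<open>|V : V \<inter> gVg\<^sup>-\<^sup>1|\<close> and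
  \<open>|gVg\<^sup>-\<^sup>1 : V \<inter> gVg\<^sup>-\<^sup>1|\<close> are the sizes of the \<open>V\<close>-orbits of \<open>g v\<close> and \<open>g\<^sup>-\<^sup>1 v\<close>, so the
  modular function at \<open>g\<close> is the quotient of the sizes of two paired suborbits. By connectedness
  the group is generated by \<open>V\<close>, on which the modular function is 1, and the \<open>g\<close> moving \<open>v\<close> to a
  neighbour; hence the image of the modular function is generated by the quotients for the paired
  orbits of \<open>V\<close> on the neighbours of \<open>v\<close>. Discarding the pairs of orbits of equal size, the
  remaining orbits are disjoint and their sizes add up to at most the degree. If all pairs are
  discarded the image is trivial, and the degree is at least 2 because the group is not compact.

  The modular function is defined through a choice of Haar measure, so one has to be constructed:
  small compact open subgroups exist by van Dantzig's theorem, the normalised number of right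
  cosets of a shrinking open subgroup that meet a compact set converges to a content, and the
  content induces a Radon measure. A right Haar measure is determined up to scaling by its values
  on compact open sets, and each of these is a finite union of right cosets of a compact open
  subgroup. Hence right Haar measures are proportional; comparing one with its left translates
  gives the modular function.
\<close>

section \<open>Subgroups and right cosets\<close>

definition add_subgroup :: "'a::group_add set \<Rightarrow> bool" where
  "add_subgroup W \<longleftrightarrow> 0 \<in> W \<and> (\<forall>x\<in>W. \<forall>y\<in>W. x + y \<in> W) \<and> (\<forall>x\<in>W. - x \<in> W)"

definition right_coset :: "'a::group_add set \<Rightarrow> 'a \<Rightarrow> 'a set" where
  "right_coset W x = (\<lambda>w. w + x) ` W"

text \<open>When \<open>W \<subseteq> S\<close> are subgroups, this is the index of \<open>W\<close> in \<open>S\<close>.\<close>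

definition coset_count :: "'a::group_add set \<Rightarrow> 'a set \<Rightarrow> nat" where
  "coset_count W S = card (right_coset W ` S)"

lemma add_subgroup_zero: "add_subgroup W \<Longrightarrow> 0 \<in> W"
  and add_subgroup_add: "add_subgroup W \<Longrightarrow> x \<in> W \<Longrightarrow> y \<in> W \<Longrightarrow> x + y \<in> W"
  and add_subgroup_uminus: "add_subgroup W \<Longrightarrow> x \<in> W \<Longrightarrow> - x \<in> W"
  by (auto simp: add_subgroup_def)

lemma add_subgroup_diff: "add_subgroup W \<Longrightarrow> x \<in> W \<Longrightarrow> y \<in> W \<Longrightarrow> x - y \<in> W"
  by (metis add_subgroup_add add_subgroup_uminus add_uminus_conv_diff)

lemma add_subgroup_diff_commute: "add_subgroup W \<Longrightarrow> x - y \<in> W \<longleftrightarrow> y - x \<in> W"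
  by (metis add_subgroup_uminus minus_diff_eq)

lemma add_subgroup_diff_trans:
  assumes "add_subgroup W" "x - y \<in> W" "y - z \<in> W"
  shows "x - z \<in> W"
  using add_subgroup_add[OF assms] by (simp add: algebra_simps)

lemma add_subgroup_Int: "add_subgroup W \<Longrightarrow> add_subgroup W' \<Longrightarrow> add_subgroup (W \<inter> W')"
  by (auto simp: add_subgroup_def)

lemma add_subgroup_stabiliser:
  fixes C :: "'a::group_add set"
  shows "add_subgroup {x. \<forall>c. x + c \<in> C \<longleftrightarrow> c \<in> C}"
proof -
  have "- x + c \<in> C \<longleftrightarrow> c \<in> C" if "\<forall>c. x + c \<in> C \<longleftrightarrow> c \<in> C" for x c
    using that[rule_format, of "- x + c"] by (simp flip: add.assoc)
  then show ?thesis by (simp add: add_subgroup_def add.assoc)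
qed

lemma subset_set_plus: "0 \<in> A \<Longrightarrow> B \<subseteq> A + B" for A B :: "'a::monoid_add set"
  by (metis add_0 set_plus_intro subsetI)

lemma set_plus_absorb:
  assumes "add_subgroup V" "add_subgroup W" "W \<subseteq> V"
  shows "W + V = V"
  using assms subset_set_plus[of W V] add_subgroup_zero[of W]
  by (auto elim!: set_plus_elim intro: add_subgroup_add)

lemma mem_right_coset_iff: "y \<in> right_coset W x \<longleftrightarrow> y - x \<in> W"
  by (force simp: right_coset_def image_iff diff_eq_eq)

lemma right_coset_eq_iff:
  assumes "add_subgroup W"
  shows "right_coset W x = right_coset W y \<longleftrightarrow> x - y \<in> W"
proof
  assume "right_coset W x = right_coset W y"
  then show "x - y \<in> W"
    using add_subgroup_zero[OF assms] by (metis diff_self mem_right_coset_iff)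
next
  assume "x - y \<in> W"
  then show "right_coset W x = right_coset W y"
    using add_subgroup_diff_trans[OF assms] add_subgroup_diff_commute[OF assms]
    by (auto simp: set_eq_iff mem_right_coset_iff)
qed

lemma right_coset_disjoint:
  assumes "add_subgroup W" "right_coset W x \<noteq> right_coset W y"
  shows "right_coset W x \<inter> right_coset W y = {}"
  using assms by (metis disjoint_iff mem_right_coset_iff right_coset_eq_iff)

lemma Union_right_cosets: "(\<Union>x\<in>S. right_coset W x) = W + S"
  by (auto simp: right_coset_def elim!: set_plus_elim)

lemma right_coset_add_right: "(\<lambda>x. x + g) ` right_coset W x = right_coset W (x + g)"
  by (simp add: right_coset_def image_image add.assoc)

lemma coset_count_add_right: "coset_count W ((\<lambda>x. x + g) ` S) = coset_count W S"
proof -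
  have "right_coset W ` (\<lambda>x. x + g) ` S = (`) (\<lambda>x. x + g) ` right_coset W ` S"
    by (simp add: image_image right_coset_add_right)
  moreover have "inj_on ((`) (\<lambda>x. x + g)) A" for A
    by (intro inj_onI) (simp add: inj_image_eq_iff inj_def)
  ultimately show ?thesis by (simp add: coset_count_def card_image)
qed

lemma card_image_cong_fibres:
  assumes "\<And>x y. x \<in> S \<Longrightarrow> y \<in> S \<Longrightarrow> f x = f y \<longleftrightarrow> g x = g y"
  shows "card (f ` S) = card (g ` S)"
proof (rule bij_betw_same_card)
  show "bij_betw (\<lambda>c. g (inv_into S f c)) (f ` S) (g ` S)"
  proof (rule bij_betw_imageI)
    show "inj_on (\<lambda>c. g (inv_into S f c)) (f ` S)"
      using assms by (intro inj_onI) (metis f_inv_into_f inv_into_into)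
    have "g (inv_into S f (f x)) = g x" if "x \<in> S" for x
      using assms that by (metis f_inv_into_f imageI inv_into_into)
    then show "(\<lambda>c. g (inv_into S f c)) ` f ` S = g ` S"
      by (simp add: image_image)
  qed
qed

lemma coset_count_set_plus:
  assumes W: "add_subgroup W" and W': "add_subgroup W'" and "W' \<subseteq> W"
  shows "coset_count W' (W + S) = coset_count W S * coset_count W' W"
proof -
  obtain T where T: "inj_on (right_coset W) T" "right_coset W ` S = right_coset W ` T"
    using subset_image_inj[of "right_coset W ` S" "right_coset W" S] by auto
  have "W + S = (\<lambda>(w, t). w + t) ` (W \<times> T)"
    by (simp only: Union_right_cosets[symmetric] T(2))
      (simp only: Union_right_cosets set_plus_image)
  then have "coset_count W' (W + S) = card ((\<lambda>y. right_coset W' (fst y + snd y)) ` (W \<times> T))"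
    by (simp add: coset_count_def image_image case_prod_beta)
  also have "\<dots> = card ((\<lambda>y. (right_coset W' (fst y), right_coset W (snd y))) ` (W \<times> T))"
  proof (rule card_image_cong_fibres)
    fix y z assume yz: "y \<in> W \<times> T" "z \<in> W \<times> T"
    have "right_coset W (snd y) = right_coset W (snd z)"
      if "right_coset W' (fst y + snd y) = right_coset W' (fst z + snd z)"
    proof -
      have "right_coset W (fst y + snd y) = right_coset W (fst z + snd z)"
        using that \<open>W' \<subseteq> W\<close> by (auto simp: right_coset_eq_iff[OF W] right_coset_eq_iff[OF W'])
      moreover have "right_coset W (fst y + snd y) = right_coset W (snd y)"
        "right_coset W (fst z + snd z) = right_coset W (snd z)"
        using yz by (auto simp: right_coset_eq_iff[OF W])
      ultimately show ?thesis by simp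
    qed
    moreover have "right_coset W (snd y) = right_coset W (snd z) \<longleftrightarrow> snd y = snd z"
      using T(1) yz by (auto simp: inj_on_eq_iff)
    ultimately show "right_coset W' (fst y + snd y) = right_coset W' (fst z + snd z) \<longleftrightarrow>
        (right_coset W' (fst y), right_coset W (snd y)) =
        (right_coset W' (fst z), right_coset W (snd z))"
      by (auto simp: right_coset_eq_iff[OF W'] diff_add_eq_diff_diff_swap)
  qed
  also have "(\<lambda>y. (right_coset W' (fst y), right_coset W (snd y))) ` (W \<times> T) =
      right_coset W' ` W \<times> right_coset W ` S"
    by (force simp: T(2))
  finally show ?thesis by (simp add: card_cartesian_product coset_count_def)
qed

lemma coset_count_tower:
  assumes "add_subgroup V" "add_subgroup W" "add_subgroup W'" "W' \<subseteq> W" "W \<subseteq> V"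
  shows "coset_count W' V = coset_count W V * coset_count W' W"
  using coset_count_set_plus[OF assms(2-4), of V] set_plus_absorb[OF assms(1,2,5)] by simp

section \<open>Topological groups and van Dantzig's theorem\<close>

definition open_subgroup :: "'a::topological_group_add set \<Rightarrow> bool" where
  "open_subgroup W \<longleftrightarrow> open W \<and> add_subgroup W"

lemma homeomorphism_add_left:
  "homeomorphism UNIV UNIV (\<lambda>x::'a::topological_group_add. g + x) (\<lambda>x. - g + x)"
  by (rule homeomorphismI) (auto intro!: continuous_intros simp flip: add.assoc)

lemma homeomorphism_add_right:
  "homeomorphism UNIV UNIV (\<lambda>x::'a::topological_group_add. x + g) (\<lambda>x. x + - g)"
  by (rule homeomorphismI)
    (auto intro!: continuous_intros simp: add.assoc simp del: add_uminus_conv_diff)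

lemma open_homeomorphic_image: "homeomorphism UNIV UNIV f h \<Longrightarrow> open U \<Longrightarrow> open (f ` U)"
  using homeomorphism_imp_open_map[of UNIV UNIV f h U] by simp

lemma compact_homeomorphic_image: "homeomorphism UNIV UNIV f h \<Longrightarrow> compact K \<Longrightarrow> compact (f ` K)"
  by (meson compact_continuous_image continuous_on_subset homeomorphism_cont1 subset_UNIV)

lemma open_right_coset:
  fixes W :: "'a::topological_group_add set"
  assumes "open W"
  shows "open (right_coset W x)"
  unfolding right_coset_def using homeomorphism_add_right assms by (rule open_homeomorphic_image)

lemma open_set_plus:
  fixes W S :: "'a::topological_group_add set"
  assumes "open W"
  shows "open (W + S)"
  unfolding Union_right_cosets[symmetric] by (intro open_UN ballI open_right_coset assms)

lemma compact_set_plus: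
  fixes K L :: "'a::topological_group_add set"
  assumes "compact K" "compact L"
  shows "compact (K + L)"
proof -
  have "continuous_on (K \<times> L) (\<lambda>z. fst z + snd z)" by (intro continuous_intros)
  then have "compact ((\<lambda>z. fst z + snd z) ` (K \<times> L))"
    using assms by (intro compact_continuous_image compact_Times)
  then show ?thesis by (simp add: set_plus_image case_prod_beta)
qed

lemma ex_nhd_set_plus_subset:
  fixes K :: "'a::topological_group_add set"
  assumes "compact K" "open U" "K \<subseteq> U"
  shows "\<exists>N. open N \<and> 0 \<in> N \<and> N + K \<subseteq> U"
proof -
  let ?add = "\<lambda>z. fst z + snd z :: 'a"
  have "open (?add -` U)" using assms(2) by (intro open_vimage continuous_intros)
  moreover have "{0} \<times> K \<subseteq> ?add -` U" using assms(3) by auto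
  ultimately obtain N where N: "0 \<in> N" "open N" "N \<times> K \<subseteq> ?add -` U"
    by (auto dest: Elementary_Topology.tube_lemma[OF assms(1)])
  then have "N + K \<subseteq> U" by (auto elim!: set_plus_elim)
  then show ?thesis using N(1,2) by blast
qed

lemma open_add_subgroupI:
  fixes W :: "'a::topological_group_add set"
  assumes "add_subgroup W" "open N" "0 \<in> N" "N \<subseteq> W"
  shows "open_subgroup W"
proof -
  have "W \<subseteq> N + W" using assms(3) by (rule subset_set_plus)
  moreover have "N + W \<subseteq> W" using assms by (auto simp: add_subgroup_add elim!: set_plus_elim)
  ultimately have "N + W = W" by blast
  then show ?thesis using assms open_set_plus[of N W] by (simp add: open_subgroup_def)
qed

lemma open_subgroup_Int: "open_subgroup W \<Longrightarrow> open_subgroup W' \<Longrightarrow> open_subgroup (W \<inter> W')"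
  by (simp add: open_subgroup_def add_subgroup_Int open_Int)

lemma closed_open_subgroup:
  assumes "open_subgroup W"
  shows "closed W"
proof -
  have W: "add_subgroup W" using assms by (simp add: open_subgroup_def)
  have "W + - W \<subseteq> - W"
    using W by (auto elim!: set_plus_elim)
      (metis add_subgroup_add add_subgroup_uminus minus_add_cancel)
  moreover have "- W \<subseteq> W + - W" by (rule subset_set_plus[OF add_subgroup_zero[OF W]])
  ultimately have "- W = W + - W" by blast
  then show ?thesis
    using assms open_set_plus[of W "- W"] by (simp add: closed_def open_subgroup_def)
qed

lemma finite_right_cosets:
  assumes "open_subgroup W" "compact K"
  shows "finite (right_coset W ` K)"
proof -
  have W: "add_subgroup W" "open W" using assms(1) by (simp_all add: open_subgroup_def)
  have "K \<subseteq> (\<Union>x\<in>K. right_coset W x)"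
    unfolding Union_right_cosets using add_subgroup_zero[OF W(1)] by (rule subset_set_plus)
  then obtain F where F: "finite F" "K \<subseteq> (\<Union>x\<in>F. right_coset W x)"
    using assms(2) open_right_coset[OF W(2)] by (metis compactE_image)
  have "right_coset W ` K \<subseteq> right_coset W ` F"
    using F(2) by (fastforce simp: mem_right_coset_iff right_coset_eq_iff[OF W(1)])
  then show ?thesis using F(1) by (meson finite_imageI finite_subset)
qed

lemma coset_count_pos:
  assumes "open_subgroup W" "compact K" "K \<noteq> {}"
  shows "coset_count W K > 0"
  using finite_right_cosets[OF assms(1,2)] assms(3) by (simp add: coset_count_def card_gt_0_iff)

lemma coset_count_mono:
  assumes "open_subgroup W" "compact L" "K \<subseteq> L"
  shows "coset_count W K \<le> coset_count W L"
  unfolding coset_count_def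
  using finite_right_cosets[OF assms(1,2)] assms(3) by (intro card_mono image_mono)

lemma Hausdorff_space_euclidean_t2: "Hausdorff_space (euclidean :: 'a::t2_space topology)"
  by (simp add: Hausdorff_space_def disjnt_def) (metis hausdorff)

lemma ex_compact_open_nhd:
  fixes x :: "'a::t2_space"
  assumes "totally_disconnected_space TYPE('a)" "locally_compact_type TYPE('a)" "open U" "x \<in> U"
  shows "\<exists>C. compact C \<and> open C \<and> x \<in> C \<and> C \<subseteq> U"
proof -
  obtain N K where N: "open N" "x \<in> N" "N \<subseteq> K" and K: "compact K"
    using assms(2) unfolding locally_compact_type_def by metis
  let ?X = "top_of_set K"
  have "separated_between ?X {x} (K - (U \<inter> N))"
  proof (rule cut_wire_fence_theorem)
    show "compact_space ?X" using K by (simp add: compact_space_subtopology)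
    show "Hausdorff_space ?X" by (rule Hausdorff_space_subtopology[OF Hausdorff_space_euclidean_t2])
    show "closedin ?X {x}" using N by (intro closed_subset) auto
    show "closedin ?X (K - (U \<inter> N))"
      using assms(3) N(1) by (metis Diff_eq closed_Compl closedin_closed_Int open_Int)
    fix C assume "connectedin ?X C"
    then have "C \<subseteq> connected_component_set UNIV x" if "x \<in> C"
      using that by (simp add: connected_component_maximal connectedin_subtopology)
    then have "C \<subseteq> {x}" if "x \<in> C"
      using that assms(1) by (simp add: totally_disconnected_space_def)
    then show "disjnt C {x} \<or> disjnt C (K - (U \<inter> N))"
      using assms(4) N(2) by (auto simp: disjnt_def)
  qed
  then obtain C where C: "closedin ?X C" "openin ?X C" "{x} \<subseteq> C" "K - (U \<inter> N) \<subseteq> K - C"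
    unfolding separated_between by auto
  have "C \<subseteq> U \<inter> N" using C closedin_subset[OF C(1)] by auto
  moreover have "compact C" using C(1) K closedin_compact by blast
  moreover have "open C"
    using C(2) N \<open>C \<subseteq> U \<inter> N\<close> by (metis openin_open_eq openin_subset_trans Int_subset_iff)
  ultimately show ?thesis using C(3) by (intro exI[of _ C]) auto
qed

locale tdlc_group =
  fixes G :: "'g::{topological_group_add, t2_space} itself"
  assumes totally_disconnected: "totally_disconnected_space G"
    and locally_compact: "locally_compact_type G"
begin

theorem van_dantzig:
  fixes U :: "'g set"
  assumes "open U" "0 \<in> U"
  shows "\<exists>W. compact W \<and> open_subgroup W \<and> W \<subseteq> U"
proof -
  obtain C where C: "compact C" "open C" "0 \<in> C" "C \<subseteq> U"
    using ex_compact_open_nhd[OF _ _ assms] totally_disconnected locally_compact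
    unfolding totally_disconnected_space_def locally_compact_type_def by blast
  define W where "W = {x. \<forall>c. x + c \<in> C \<longleftrightarrow> c \<in> C}"
  obtain N where N: "open N" "0 \<in> N" "N + C \<subseteq> C"
    using ex_nhd_set_plus_subset[OF C(1,2)] by blast
  have "open_subgroup W"
  proof (rule open_add_subgroupI)
    show "add_subgroup W" unfolding W_def by (rule add_subgroup_stabiliser)
    show "open (N \<inter> uminus -` N)" by (intro open_Int N open_vimage continuous_intros)
    show "0 \<in> N \<inter> uminus -` N" using N(2) by simp
    have "c \<in> C" if "- x \<in> N" "x + c \<in> C" for x c
      using N(3) set_plus_intro[OF that] by (auto simp flip: add.assoc)
    then show "N \<inter> uminus -` N \<subseteq> W" using N(3) by (auto simp: W_def)
  qed
  moreover have "W \<subseteq> C"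
  proof
    fix x assume "x \<in> W"
    then have "x + 0 \<in> C" using C(3) unfolding W_def by blast
    then show "x \<in> C" by simp
  qed
  moreover have "compact W"
    using C(1) closed_open_subgroup[OF \<open>open_subgroup W\<close>] \<open>W \<subseteq> C\<close>
    by (metis compact_Int_closed inf.absorb_iff2)
  ultimately show ?thesis using C(4) by blast
qed

lemma ex_open_subgroup_set_plus_subset:
  fixes K U :: "'g set"
  assumes "compact K" "open U" "K \<subseteq> U"
  shows "\<exists>W. compact W \<and> open_subgroup W \<and> W + K \<subseteq> U"
proof -
  obtain N where N: "open N" "0 \<in> N" "N + K \<subseteq> U" using ex_nhd_set_plus_subset[OF assms] by blast
  obtain W where "compact W" "open_subgroup W" "W \<subseteq> N" using van_dantzig[OF N(1,2)] by blast
  then show ?thesis using N(3) by (meson order_refl order_trans set_plus_mono2)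
qed

end

section \<open>Radon measures\<close>

definition radon_measure :: "'a::topological_space measure \<Rightarrow> bool" where
  "radon_measure M \<longleftrightarrow>
     sets M = sets borel \<and>
     (\<forall>K. compact K \<longrightarrow> emeasure M K < \<infinity>) \<and>
     (\<forall>A\<in>sets borel. emeasure M A = (INF U\<in>{U. open U \<and> A \<subseteq> U}. emeasure M U)) \<and>
     (\<forall>U. open U \<longrightarrow> emeasure M U = (SUP K\<in>{K. compact K \<and> K \<subseteq> U}. emeasure M K))"

lemma sets_radon_measure: "radon_measure M \<Longrightarrow> sets M = sets borel"
  and radon_measure_compact_finite: "radon_measure M \<Longrightarrow> compact K \<Longrightarrow> emeasure M K < \<infinity>"
  and radon_measure_outer_regular: "radon_measure M \<Longrightarrow> A \<in> sets borel \<Longrightarrow>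
    emeasure M A = (INF U\<in>{U. open U \<and> A \<subseteq> U}. emeasure M U)"
  and radon_measure_inner_regular: "radon_measure M \<Longrightarrow> open U \<Longrightarrow>
    emeasure M U = (SUP K\<in>{K. compact K \<and> K \<subseteq> U}. emeasure M K)"
  unfolding radon_measure_def by metis+

lemma INF_mult_left_ennreal:
  fixes f :: "_ \<Rightarrow> ennreal"
  assumes "0 < r"
  shows "(INF i\<in>I. ennreal r * f i) = ennreal r * (INF i\<in>I. f i)"
proof (cases "I = {}")
  case False
  have "continuous (at_right x) (\<lambda>y. ennreal r * y)" for x
    using ennreal_continuous_on_cmult[of "ennreal r" UNIV "\<lambda>y. y"]
    by (simp add: continuous_on_eq_continuous_within continuous_at_imp_continuous_at_within)
  then show ?thesis
    using False continuous_at_Inf_mono[of "\<lambda>y. ennreal r * y" "f ` I"]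
    by (auto simp: mono_def mult_left_mono image_comp)
qed (use assms in \<open>simp add: ennreal_mult_top\<close>)

lemma radon_measure_inner_regular_compact_open:
  assumes M: "radon_measure M" and "open U"
    and sandwich: "\<And>K. compact K \<Longrightarrow> K \<subseteq> U \<Longrightarrow> \<exists>C. compact C \<and> open C \<and> K \<subseteq> C \<and> C \<subseteq> U"
  shows "emeasure M U = (SUP C\<in>{C. compact C \<and> open C \<and> C \<subseteq> U}. emeasure M C)"
proof -
  have "\<exists>C\<in>{C. compact C \<and> open C \<and> C \<subseteq> U}. emeasure M K \<le> emeasure M C"
    if K: "K \<in> {K. compact K \<and> K \<subseteq> U}" for K
  proof -
    obtain C where "compact C" "open C" "K \<subseteq> C" "C \<subseteq> U" using K sandwich[of K] by blast
    moreover from this have "emeasure M K \<le> emeasure M C"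
      by (intro emeasure_mono) (simp_all add: sets_radon_measure[OF M])
    ultimately show ?thesis by blast
  qed
  then show ?thesis
    unfolding radon_measure_inner_regular[OF M \<open>open U\<close>]
    by (intro antisym SUP_mono SUP_subset_mono) auto
qed

lemma radon_measure_proportionalI:
  fixes M N :: "'a::topological_space measure"
  assumes M: "radon_measure M" and N: "radon_measure N" and "0 < r"
    and sandwich: "\<And>K U :: 'a set. compact K \<Longrightarrow> open U \<Longrightarrow> K \<subseteq> U \<Longrightarrow>
      \<exists>C. compact C \<and> open C \<and> K \<subseteq> C \<and> C \<subseteq> U"
    and compact_open: "\<And>C. compact C \<Longrightarrow> open C \<Longrightarrow> emeasure N C = ennreal r * emeasure M C"
    and "A \<in> sets borel"
  shows "emeasure N A = ennreal r * emeasure M A"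
proof -
  have "emeasure N U = ennreal r * emeasure M U" if U: "open U" for U
  proof -
    have "emeasure L U = (SUP C\<in>{C. compact C \<and> open C \<and> C \<subseteq> U}. emeasure L C)"
      if "radon_measure L" for L
      using that U by (rule radon_measure_inner_regular_compact_open) (rule sandwich[OF _ U])
    from this[OF M] this[OF N] show ?thesis
      by (simp add: SUP_mult_left_ennreal compact_open)
  qed
  then show ?thesis
    unfolding radon_measure_outer_regular[OF M \<open>A \<in> sets borel\<close>]
      radon_measure_outer_regular[OF N \<open>A \<in> sets borel\<close>] INF_mult_left_ennreal[OF \<open>0 < r\<close>, symmetric]
    by (intro INF_cong) simp_all
qed

lemma homeomorphic_image_subset_iff: "homeomorphism UNIV UNIV f h \<Longrightarrow> f ` A \<subseteq> B \<longleftrightarrow> A \<subseteq> h ` B"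
  by (auto simp: homeomorphism_def subset_iff) (metis image_iff)+

lemma homeomorphic_image_eq_vimage: "homeomorphism UNIV UNIV f h \<Longrightarrow> f ` A = h -` A"
  unfolding homeomorphism_def set_eq_iff image_iff vimage_eq by (metis UNIV_I)

lemma compact_subsets_homeomorphic_image:
  assumes "homeomorphism UNIV UNIV f h"
  shows "{K. compact K \<and> K \<subseteq> f ` U} = (`) f ` {K. compact K \<and> K \<subseteq> U}"
proof (intro equalityI subsetI)
  fix K assume "K \<in> {K. compact K \<and> K \<subseteq> f ` U}"
  then have "compact (h ` K)" "h ` K \<subseteq> U"
    using compact_homeomorphic_image[OF homeomorphism_symD[OF assms]]
      homeomorphic_image_subset_iff[OF homeomorphism_symD[OF assms]] by auto
  moreover have "f ` h ` K = K" using assms by (simp add: homeomorphism_def image_image)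
  ultimately show "K \<in> (`) f ` {K. compact K \<and> K \<subseteq> U}" by (metis (lifting) image_eqI mem_Collect_eq)
qed (use compact_homeomorphic_image[OF assms] in auto)

lemma open_supersets_homeomorphic_image:
  assumes "homeomorphism UNIV UNIV f h"
  shows "{U. open U \<and> f ` A \<subseteq> U} = (`) f ` {U. open U \<and> A \<subseteq> U}"
proof (intro equalityI subsetI)
  fix U assume "U \<in> {U. open U \<and> f ` A \<subseteq> U}"
  then have "open (h ` U)" "A \<subseteq> h ` U"
    using open_homeomorphic_image[OF homeomorphism_symD[OF assms]]
      homeomorphic_image_subset_iff[OF assms] by auto
  moreover have "f ` h ` U = U" using assms by (simp add: homeomorphism_def image_image)
  ultimately show "U \<in> (`) f ` {U. open U \<and> A \<subseteq> U}" by (metis (lifting) image_eqI mem_Collect_eq)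
qed (use open_homeomorphic_image[OF assms] in auto)

lemma borel_homeomorphic_image:
  assumes "homeomorphism UNIV UNIV f h" "A \<in> sets borel"
  shows "f ` A \<in> sets borel"
proof -
  have "h \<in> borel_measurable borel"
    using assms(1) by (intro borel_measurable_continuous_onI) (simp add: homeomorphism_def)
  then show ?thesis
    unfolding homeomorphic_image_eq_vimage[OF assms(1)] using assms(2)
    by (rule measurable_sets_borel)
qed

lemma emeasure_distr_homeomorphism:
  assumes "homeomorphism UNIV UNIV f h" "sets M = sets borel" "A \<in> sets borel"
  shows "emeasure (distr M borel h) A = emeasure M (f ` A)"
proof -
  have "h \<in> measurable M borel"
    using assms(1,2) borel_measurable_continuous_onI[of h]
    by (simp add: homeomorphism_def cong: measurable_cong_sets)
  moreover have "h -` A \<inter> space M = f ` A"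
    using sets_eq_imp_space_eq[OF assms(2)] by (simp add: homeomorphic_image_eq_vimage[OF assms(1)])
  ultimately show ?thesis using assms(3) by (simp add: emeasure_distr)
qed

lemma radon_measure_distr_homeomorphism:
  fixes M :: "'a::t2_space measure" and h :: "'a \<Rightarrow> 'b::t2_space"
  assumes f: "homeomorphism UNIV UNIV f h" and M: "radon_measure M"
  shows "radon_measure (distr M borel h)"
proof -
  have distr: "emeasure (distr M borel h) A = emeasure M (f ` A)" if "A \<in> sets borel" for A
    using emeasure_distr_homeomorphism[OF f sets_radon_measure[OF M] that] .
  show ?thesis
    unfolding radon_measure_def
  proof (intro conjI allI ballI impI)
    show "emeasure (distr M borel h) K < \<infinity>" if "compact K" for K
      using that compact_homeomorphic_image[OF f] radon_measure_compact_finite[OF M]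
      by (simp add: distr borel_compact)
    fix A :: "'b set" assume A: "A \<in> sets borel"
    have "emeasure (distr M borel h) A = (INF U\<in>{U. open U \<and> A \<subseteq> U}. emeasure M (f ` U))"
      using radon_measure_outer_regular[OF M borel_homeomorphic_image[OF f A]] distr[OF A]
      by (simp add: open_supersets_homeomorphic_image[OF f] image_image)
    also have "\<dots> = (INF U\<in>{U. open U \<and> A \<subseteq> U}. emeasure (distr M borel h) U)"
      by (intro INF_cong) (simp_all add: distr)
    finally show "emeasure (distr M borel h) A =
      (INF U\<in>{U. open U \<and> A \<subseteq> U}. emeasure (distr M borel h) U)" .
  next
    fix U :: "'b set" assume U: "open U"
    have "emeasure (distr M borel h) U = (SUP K\<in>{K. compact K \<and> K \<subseteq> U}. emeasure M (f ` K))"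
      using radon_measure_inner_regular[OF M open_homeomorphic_image[OF f U]] U
      by (simp add: compact_subsets_homeomorphic_image[OF f] image_image distr)
    also have "\<dots> = (SUP K\<in>{K. compact K \<and> K \<subseteq> U}. emeasure (distr M borel h) K)"
      by (intro SUP_cong) (simp_all add: distr borel_compact)
    finally show "emeasure (distr M borel h) U =
      (SUP K\<in>{K. compact K \<and> K \<subseteq> U}. emeasure (distr M borel h) K)" .
  qed simp
qed

section \<open>Radon measures from contents\<close>

lemma compact_subset_Un_open:
  fixes K :: "'a::t2_space set"
  assumes "compact K" "open U1" "open U2" "K \<subseteq> U1 \<union> U2"
  obtains K1 K2 where "compact K1" "compact K2" "K = K1 \<union> K2" "K1 \<subseteq> U1" "K2 \<subseteq> U2"
proof -
  have "compact (K - U1)" "compact (K - U2)" using assms by (auto intro: compact_diff)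
  moreover have "disjnt (K - U1) (K - U2)" using assms by (auto simp: disjnt_def)
  ultimately obtain V1 V2 where V: "open V1" "open V2" "K - U1 \<subseteq> V1" "K - U2 \<subseteq> V2" "disjnt V1 V2"
    using Hausdorff_space_euclidean_t2 unfolding Hausdorff_space_compact_sets
    by (metis compactin_euclidean_iff open_openin)
  show thesis
  proof
    show "compact (K - V1)" "compact (K - V2)" using assms V by (auto intro: compact_diff)
    show "K = (K - V1) \<union> (K - V2)" using V by (auto simp: disjnt_iff)
    show "K - V1 \<subseteq> U1" "K - V2 \<subseteq> U2" using V by auto
  qed
qed

locale compact_content =
  fixes \<kappa> :: "'a::t2_space set \<Rightarrow> ennreal"
  assumes content_mono: "compact K \<Longrightarrow> compact L \<Longrightarrow> K \<subseteq> L \<Longrightarrow> \<kappa> K \<le> \<kappa> L"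
    and content_empty: "\<kappa> {} = 0"
    and content_Un_le: "compact K \<Longrightarrow> compact L \<Longrightarrow> \<kappa> (K \<union> L) \<le> \<kappa> K + \<kappa> L"
    and content_Un_disjoint_ge: "compact K \<Longrightarrow> compact L \<Longrightarrow> K \<inter> L = {} \<Longrightarrow> \<kappa> K + \<kappa> L \<le> \<kappa> (K \<union> L)"
begin

definition inner_content :: "'a set \<Rightarrow> ennreal" where
  "inner_content U = (SUP K\<in>{K. compact K \<and> K \<subseteq> U}. \<kappa> K)"

definition outer_content :: "'a set \<Rightarrow> ennreal" where
  "outer_content A = (INF U\<in>{U. open U \<and> A \<subseteq> U}. inner_content U)"

lemma inner_content_mono: "U \<subseteq> U' \<Longrightarrow> inner_content U \<le> inner_content U'"
  unfolding inner_content_def by (rule SUP_subset_mono) auto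

lemma content_le_inner_content: "compact K \<Longrightarrow> K \<subseteq> U \<Longrightarrow> \<kappa> K \<le> inner_content U"
  unfolding inner_content_def by (rule SUP_upper) auto

lemma inner_content_le_content: "compact K \<Longrightarrow> U \<subseteq> K \<Longrightarrow> inner_content U \<le> \<kappa> K"
  unfolding inner_content_def by (intro SUP_least content_mono) auto

lemma outer_content_mono: "A \<subseteq> B \<Longrightarrow> outer_content A \<le> outer_content B"
  unfolding outer_content_def by (rule INF_superset_mono) auto

lemma outer_content_open: "open U \<Longrightarrow> outer_content U = inner_content U"
  unfolding outer_content_def by (auto intro!: antisym INF_lower INF_greatest inner_content_mono)

lemma outer_content_le_inner_content: "open U \<Longrightarrow> A \<subseteq> U \<Longrightarrow> outer_content A \<le> inner_content U"
  unfolding outer_content_def by (rule INF_lower) auto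

lemma content_le_outer_content: "compact K \<Longrightarrow> \<kappa> K \<le> outer_content K"
  unfolding outer_content_def by (intro INF_greatest content_le_inner_content) auto

lemma content_le_sum_inner_content:
  fixes U :: "nat \<Rightarrow> 'a set"
  assumes "compact K" "\<And>i. open (U i)" "K \<subseteq> (\<Union>i<n. U i)"
  shows "\<kappa> K \<le> (\<Sum>i<n. inner_content (U i))"
  using assms(1,3)
proof (induction n arbitrary: K)
  case 0
  then show ?case by (simp add: content_empty)
next
  case (Suc n)
  have "K \<subseteq> (\<Union>i<n. U i) \<union> U n" using Suc.prems(2) by (simp add: lessThan_Suc Un_commute)
  then obtain K1 K2 where K: "compact K1" "compact K2" "K = K1 \<union> K2" "K1 \<subseteq> (\<Union>i<n. U i)" "K2 \<subseteq> U n"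
    by (rule compact_subset_Un_open[OF Suc.prems(1), rotated 2]) (simp_all add: assms(2) open_UN)
  have "\<kappa> K \<le> \<kappa> K1 + \<kappa> K2" using K content_Un_le by simp
  also have "\<dots> \<le> (\<Sum>i<n. inner_content (U i)) + inner_content (U n)"
    using K Suc.IH[OF K(1,4)] content_le_inner_content[OF K(2,5)] by (intro add_mono)
  finally show ?case by simp
qed

lemma inner_content_UN_le:
  fixes U :: "nat \<Rightarrow> 'a set"
  assumes "\<And>i. open (U i)"
  shows "inner_content (\<Union>i. U i) \<le> (\<Sum>i. inner_content (U i))"
  unfolding inner_content_def[of "\<Union>i. U i"]
proof (rule SUP_least)
  fix K assume "K \<in> {K. compact K \<and> K \<subseteq> (\<Union>i. U i)}"
  then have K: "compact K" "K \<subseteq> (\<Union>i\<in>UNIV. U i)" by auto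
  obtain I where I: "finite I" "K \<subseteq> (\<Union>i\<in>I. U i)"
    by (rule compactE_image[OF K(1) assms K(2)])
  obtain n where "I \<subseteq> {..<n}" using I(1) finite_nat_bounded by blast
  then have "K \<subseteq> (\<Union>i<n. U i)" using I(2) by blast
  then have "\<kappa> K \<le> (\<Sum>i<n. inner_content (U i))"
    by (rule content_le_sum_inner_content[OF K(1) assms])
  also have "\<dots> \<le> (\<Sum>i. inner_content (U i))" by (intro sum_le_suminf) auto
  finally show "\<kappa> K \<le> (\<Sum>i. inner_content (U i))" .
qed

lemma outer_content_UN_le:
  fixes A :: "nat \<Rightarrow> 'a set"
  shows "outer_content (\<Union>i. A i) \<le> (\<Sum>i. outer_content (A i))"
proof (rule ennreal_le_epsilon)
  fix e :: real assume e: "0 < e" "(\<Sum>n. outer_content (A n)) < top"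
  then have less: "outer_content (A n) < outer_content (A n) + e * (1/2)^Suc n" for n
    by (auto simp add: less_top dest!: ennreal_suminf_lessD)
  have "\<exists>U. open U \<and> A n \<subseteq> U \<and> inner_content U \<le> outer_content (A n) + e * (1/2)^Suc n" for n
    using less[of n] unfolding outer_content_def[of "A n"] INF_less_iff by (auto intro: less_imp_le)
  then obtain U where U: "\<And>n. open (U n)" "\<And>n. A n \<subseteq> U n"
      "\<And>n. inner_content (U n) \<le> outer_content (A n) + e * (1/2)^Suc n"
    by metis
  have "outer_content (\<Union>i. A i) \<le> inner_content (\<Union>i. U i)"
    using U by (intro outer_content_le_inner_content) auto
  also have "\<dots> \<le> (\<Sum>i. inner_content (U i))" using U(1) by (rule inner_content_UN_le)
  also have "\<dots> \<le> (\<Sum>n. outer_content (A n) + e * (1/2) ^ Suc n)"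
    by (intro suminf_le U(3)) auto
  also have "\<dots> = (\<Sum>n. outer_content (A n)) + (\<Sum>n. ennreal e * ennreal ((1/2) ^ Suc n))"
    using e(1) by (subst suminf_add[symmetric])
      (auto simp del: ennreal_suminf_cmult simp add: ennreal_mult[symmetric])
  also have "\<dots> = (\<Sum>n. outer_content (A n)) + e"
    unfolding ennreal_suminf_cmult
    by (subst suminf_ennreal_eq[OF zero_le_power power_half_series]) auto
  finally show "outer_content (\<Union>i. A i) \<le> (\<Sum>n. outer_content (A n)) + e" .
qed

lemma outer_measure_space_outer_content: "outer_measure_space (Pow UNIV) outer_content"
proof -
  have "inner_content {} = 0"
    using inner_content_le_content[of "{}" "{}"] by (simp add: content_empty)
  then show ?thesis
    unfolding outer_measure_space_def positive_def increasing_def countably_subadditive_def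
    using outer_content_open[of "{}"] outer_content_mono outer_content_UN_le by simp
qed

lemma content_add_inner_content_Diff_le:
  assumes "compact K" "K \<subseteq> U"
  shows "\<kappa> K + inner_content (U - K) \<le> inner_content U"
proof -
  have "\<kappa> K + \<kappa> L \<le> inner_content U" if "compact L" "L \<subseteq> U - K" for L
  proof -
    have "\<kappa> K + \<kappa> L \<le> \<kappa> (K \<union> L)" using assms that by (intro content_Un_disjoint_ge) auto
    also have "\<dots> \<le> inner_content U" using assms that by (intro content_le_inner_content) auto
    finally show ?thesis .
  qed
  moreover have "\<kappa> K + inner_content (U - K) = (SUP L\<in>{L. compact L \<and> L \<subseteq> U - K}. \<kappa> K + \<kappa> L)"
    unfolding inner_content_def by (subst ennreal_SUP_add_right) auto
  ultimately show ?thesis by (auto intro: SUP_least)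
qed

lemma inner_content_Int_add_outer_content_Diff_le:
  assumes "open U" "open O'"
  shows "inner_content (O' \<inter> U) + outer_content (O' - U) \<le> inner_content O'"
proof -
  have "\<kappa> K + outer_content (O' - U) \<le> inner_content O'" if K: "compact K" "K \<subseteq> O' \<inter> U" for K
  proof -
    have "outer_content (O' - U) \<le> inner_content (O' - K)"
      using K assms(2) by (intro outer_content_le_inner_content open_Diff compact_imp_closed) auto
    then have "\<kappa> K + outer_content (O' - U) \<le> \<kappa> K + inner_content (O' - K)" by (rule add_left_mono)
    also have "\<dots> \<le> inner_content O'" using K by (intro content_add_inner_content_Diff_le) auto
    finally show ?thesis .
  qed
  moreover have "inner_content (O' \<inter> U) + outer_content (O' - U) =
      (SUP K\<in>{K. compact K \<and> K \<subseteq> O' \<inter> U}. \<kappa> K + outer_content (O' - U))"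
    unfolding inner_content_def by (subst ennreal_SUP_add_left) auto
  ultimately show ?thesis by (auto intro: SUP_least)
qed

lemma outer_content_split_open:
  assumes "open U"
  shows "outer_content (A \<inter> U) + outer_content (A - U) = outer_content A"
proof (rule antisym)
  show "outer_content (A \<inter> U) + outer_content (A - U) \<le> outer_content A"
    unfolding outer_content_def[of A]
  proof (rule INF_greatest)
    fix O' assume "O' \<in> {U. open U \<and> A \<subseteq> U}"
    then have O': "open O'" "A \<subseteq> O'" by auto
    have "outer_content (A \<inter> U) + outer_content (A - U) \<le>
        inner_content (O' \<inter> U) + outer_content (O' - U)"
      using O' assms by (intro add_mono outer_content_le_inner_content outer_content_mono) auto
    also have "\<dots> \<le> inner_content O'"
      by (rule inner_content_Int_add_outer_content_Diff_le[OF assms O'(1)])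
    finally show "outer_content (A \<inter> U) + outer_content (A - U) \<le> inner_content O'" .
  qed
  have "subadditive (Pow UNIV) outer_content"
    using outer_measure_space_outer_content
    by (intro ring_of_sets.countably_subadditive_subadditive[OF ring_of_sets_Pow])
      (auto simp: outer_measure_space_def)
  then have "outer_content ((A \<inter> U) \<union> (A - U)) \<le> outer_content (A \<inter> U) + outer_content (A - U)"
    unfolding subadditive_def by (auto simp: disjoint_iff)
  then show "outer_content A \<le> outer_content (A \<inter> U) + outer_content (A - U)"
    by (simp add: Int_Diff_Un)
qed

definition content_measure :: "'a measure" where
  "content_measure = measure_of UNIV (sets borel) outer_content"

lemma sets_content_measure: "sets content_measure = sets borel"
  unfolding content_measure_def by (metis sets.sets_measure_of_eq space_borel)

lemma emeasure_content_measure: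
  assumes "A \<in> sets borel"
  shows "emeasure content_measure A = outer_content A"
proof -
  let ?L = "lambda_system UNIV (Pow UNIV) outer_content"
  have L: "measure_space UNIV ?L outer_content"
    by (rule sigma_algebra.caratheodory_lemma[OF sigma_algebra_Pow outer_measure_space_outer_content])
  then interpret L: sigma_algebra UNIV ?L by (simp add: measure_space_def)
  have "U \<in> ?L" if "open U" for U
    unfolding algebra.lambda_system_eq[OF algebra_Pow] using outer_content_split_open[OF that] by simp
  then have "sets borel \<subseteq> ?L"
    unfolding sets_borel by (intro L.sigma_sets_subset) auto
  then have "measure_space UNIV (sets borel) outer_content"
    by (intro measure_down[OF L]) (metis sets.sigma_algebra_axioms space_borel)
  then show ?thesis
    using assms by (simp add: content_measure_def emeasure_measure_of_sigma measure_space_def)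
qed

lemma emeasure_content_measure_open: "open U \<Longrightarrow> emeasure content_measure U = inner_content U"
  by (simp add: emeasure_content_measure outer_content_open)

lemma emeasure_content_measure_homeomorphic_image:
  assumes f: "homeomorphism UNIV UNIV f h"
    and invariant: "\<And>K. compact K \<Longrightarrow> \<kappa> (f ` K) = \<kappa> K" and "A \<in> sets borel"
  shows "emeasure content_measure (f ` A) = emeasure content_measure A"
proof -
  have "(\<lambda>K. \<kappa> (f ` K)) ` {K. compact K \<and> K \<subseteq> U} = \<kappa> ` {K. compact K \<and> K \<subseteq> U}" for U
    using invariant by (intro image_cong) auto
  then have "inner_content (f ` U) = inner_content U" for U
    by (simp add: inner_content_def compact_subsets_homeomorphic_image[OF f] image_image)
  then have "outer_content (f ` A) = outer_content A"
    by (simp add: outer_content_def open_supersets_homeomorphic_image[OF f] image_image)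
  then show ?thesis
    using assms(3) borel_homeomorphic_image[OF f] by (simp add: emeasure_content_measure)
qed

lemma radon_measure_content_measure:
  assumes compact_nhd: "\<And>K::'a set. compact K \<Longrightarrow> \<exists>U L. open U \<and> compact L \<and> K \<subseteq> U \<and> U \<subseteq> L"
    and finite: "\<And>K. compact K \<Longrightarrow> \<kappa> K < \<infinity>"
  shows "radon_measure content_measure"
  unfolding radon_measure_def
proof (intro conjI allI ballI impI)
  show "emeasure content_measure K < \<infinity>" if K: "compact K" for K
  proof -
    obtain U L where UL: "open U" "compact L" "K \<subseteq> U" "U \<subseteq> L" using compact_nhd[OF K] by blast
    have "emeasure content_measure K \<le> inner_content U"
      using UL K by (simp add: emeasure_content_measure borel_compact outer_content_le_inner_content)
    also have "\<dots> \<le> \<kappa> L" using UL by (intro inner_content_le_content)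
    also have "\<dots> < \<infinity>" using finite[OF UL(2)] .
    finally show ?thesis .
  qed
  show "emeasure content_measure A = (INF U\<in>{U. open U \<and> A \<subseteq> U}. emeasure content_measure U)"
    if "A \<in> sets borel" for A
    unfolding emeasure_content_measure[OF that] outer_content_def[of A]
    by (rule INF_cong) (simp_all add: emeasure_content_measure_open)
  show "emeasure content_measure U = (SUP K\<in>{K. compact K \<and> K \<subseteq> U}. emeasure content_measure K)"
    if "open U" for U
  proof (rule antisym)
    show "emeasure content_measure U \<le> (SUP K\<in>{K. compact K \<and> K \<subseteq> U}. emeasure content_measure K)"
      unfolding emeasure_content_measure_open[OF that] inner_content_def
      by (rule SUP_mono) (auto simp: emeasure_content_measure borel_compact content_le_outer_content)
    show "(SUP K\<in>{K. compact K \<and> K \<subseteq> U}. emeasure content_measure K) \<le> emeasure content_measure U"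
      using that by (intro SUP_least emeasure_mono) (auto simp: sets_content_measure)
  qed
qed (rule sets_content_measure)

end

section \<open>Existence of a right Haar measure\<close>

lemma right_haar_iff:
  "right_haar M \<longleftrightarrow> radon_measure M \<and>
     (\<forall>A\<in>sets borel. \<forall>g. emeasure M ((\<lambda>x. x + g) ` A) = emeasure M A) \<and>
     (\<forall>U. open U \<and> U \<noteq> {} \<longrightarrow> emeasure M U > 0)"
  unfolding right_haar_def radon_measure_def
  by (intro iffI; elim conjE; intro conjI; assumption)

lemma INF_add_INF_ennreal:
  fixes f :: "'i \<Rightarrow> ennreal" and g :: "'j \<Rightarrow> ennreal"
  assumes "I \<noteq> {}" "J \<noteq> {}"
  shows "(INF i\<in>I. f i) + (INF j\<in>J. g j) = (INF i\<in>I. INF j\<in>J. f i + g j)"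
proof -
  have add_const: "Inf S + c = (INF x\<in>S. x + c)" if "S \<noteq> {}" for S :: "ennreal set" and c
    using continuous_at_Inf_mono[of "\<lambda>x. x + c" S] that
      continuous_add[of "at_right (Inf S)" "\<lambda>x. x" "\<lambda>x. c"]
    by (auto simp: mono_def)
  show ?thesis
    using add_const[of "f ` I"] add_const[of "g ` J"] assms
    by (simp add: image_image add.commute) (rule INF_commute)
qed

locale compact_open_subgroup =
  fixes V :: "'g::{topological_group_add, t2_space} set"
  assumes compact_V: "compact V" and open_subgroup_V: "open_subgroup V"
begin

definition open_subgroups :: "'g set set" where
  "open_subgroups = {W. open_subgroup W \<and> W \<subseteq> V}"

definition normalized_count :: "'g set \<Rightarrow> 'g set \<Rightarrow> real" where
  "normalized_count W S = real (coset_count W S) / real (coset_count W V)"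

text \<open>By \<open>normalized_count_antimono\<close> below, the infimum is a limit along the directed set of
  open subgroups of \<open>V\<close>.\<close>

definition haar_content :: "'g set \<Rightarrow> ennreal" where
  "haar_content S = (INF W\<in>open_subgroups. ennreal (normalized_count W S))"

lemma V_in_open_subgroups: "V \<in> open_subgroups"
  by (simp add: open_subgroups_def open_subgroup_V)

lemma open_subgroups_Int: "W \<in> open_subgroups \<Longrightarrow> W' \<in> open_subgroups \<Longrightarrow> W \<inter> W' \<in> open_subgroups"
  by (auto simp: open_subgroups_def open_subgroup_Int)

lemma open_subgroupsD:
  assumes "W \<in> open_subgroups"
  shows "open_subgroup W" "add_subgroup W" "W \<noteq> {}" "compact W"
proof -
  show W: "open_subgroup W" "add_subgroup W" "W \<noteq> {}"
    using assms by (auto simp: open_subgroups_def open_subgroup_def add_subgroup_def)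
  show "compact W"
    using assms compact_Int_closed[OF compact_V closed_open_subgroup[OF W(1)]]
    by (simp add: open_subgroups_def Int_absorb1)
qed

lemma coset_count_V_pos: "W \<in> open_subgroups \<Longrightarrow> coset_count W V > 0"
  using open_subgroupsD(3)[OF V_in_open_subgroups]
  by (simp add: coset_count_pos compact_V open_subgroupsD(1))

lemma coset_count_V:
  assumes "W \<in> open_subgroups" "W' \<in> open_subgroups" "W' \<subseteq> W"
  shows "coset_count W' V = coset_count W V * coset_count W' W"
  using assms open_subgroupsD(2) V_in_open_subgroups
  by (intro coset_count_tower) (simp_all add: open_subgroups_def)

lemma normalized_count_nonneg: "normalized_count W S \<ge> 0"
  by (simp add: normalized_count_def)

lemma normalized_count_mono:
  assumes "W \<in> open_subgroups" "compact L" "K \<subseteq> L"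
  shows "normalized_count W K \<le> normalized_count W L"
  using coset_count_mono[OF open_subgroupsD(1)[OF assms(1)] assms(2,3)]
  by (simp add: normalized_count_def divide_right_mono)

lemma normalized_count_antimono:
  assumes W: "W \<in> open_subgroups" "W' \<in> open_subgroups" "W' \<subseteq> W" and K: "compact K"
  shows "normalized_count W' K \<le> normalized_count W K"
proof -
  have "coset_count W' K \<le> coset_count W K * coset_count W' W"
    unfolding coset_count_set_plus[OF W(1,2)[THEN open_subgroupsD(2)] W(3), symmetric]
    using W K by (intro coset_count_mono compact_set_plus subset_set_plus add_subgroup_zero)
      (auto dest: open_subgroupsD)
  then have "real (coset_count W' K) \<le> real (coset_count W K) * real (coset_count W' W)"
    by (metis of_nat_le_iff of_nat_mult)
  moreover have "coset_count W' W > 0"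
    using coset_count_V[OF W] coset_count_V_pos[OF W(2)] by (metis mult_0_right neq0_conv)
  ultimately show ?thesis
    using coset_count_V_pos[OF W(1)]
    by (simp add: normalized_count_def coset_count_V[OF W] field_simps)
qed

lemma haar_content_le: "W \<in> open_subgroups \<Longrightarrow> haar_content S \<le> ennreal (normalized_count W S)"
  unfolding haar_content_def by (rule INF_lower)

lemma haar_content_add_right: "haar_content ((\<lambda>x. x + g) ` S) = haar_content S"
  by (simp add: haar_content_def normalized_count_def coset_count_add_right)

lemma haar_content_mono: "compact L \<Longrightarrow> K \<subseteq> L \<Longrightarrow> haar_content K \<le> haar_content L"
  unfolding haar_content_def by (intro INF_mono) (auto intro!: ennreal_leI normalized_count_mono)

lemma haar_content_Un_le:
  assumes "compact K" "compact L"
  shows "haar_content (K \<union> L) \<le> haar_content K + haar_content L"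
proof -
  have "haar_content K + haar_content L = (INF W1\<in>open_subgroups. INF W2\<in>open_subgroups.
      ennreal (normalized_count W1 K) + ennreal (normalized_count W2 L))"
    unfolding haar_content_def using V_in_open_subgroups by (intro INF_add_INF_ennreal) auto
  moreover have "haar_content (K \<union> L) \<le>
      ennreal (normalized_count W1 K) + ennreal (normalized_count W2 L)"
    if W: "W1 \<in> open_subgroups" "W2 \<in> open_subgroups" for W1 W2
  proof -
    let ?W = "W1 \<inter> W2"
    have "haar_content (K \<union> L) \<le> ennreal (normalized_count ?W (K \<union> L))"
      using W by (intro haar_content_le open_subgroups_Int)
    also have "normalized_count ?W (K \<union> L) \<le> normalized_count ?W K + normalized_count ?W L"
      unfolding normalized_count_def coset_count_def image_Un add_divide_distrib[symmetric]
      by (intro divide_right_mono) (auto simp flip: of_nat_add intro: card_Un_le)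
    also have "\<dots> \<le> normalized_count W1 K + normalized_count W2 L"
      using W assms by (intro add_mono normalized_count_antimono open_subgroups_Int) auto
    finally show ?thesis by (simp add: ennreal_leI normalized_count_nonneg flip: ennreal_plus)
  qed
  ultimately show ?thesis by (auto intro: INF_greatest)
qed

lemma normalized_count_Un:
  assumes W: "W \<in> open_subgroups" and KL: "compact K" "compact L" and disjoint: "(W + K) \<inter> L = {}"
  shows "normalized_count W (K \<union> L) = normalized_count W K + normalized_count W L"
proof -
  have "right_coset W x \<noteq> right_coset W y" if "x \<in> K" "y \<in> L" for x y
  proof -
    have "y \<notin> right_coset W x" using disjoint that unfolding Union_right_cosets[symmetric] by blast
    moreover have "y \<in> right_coset W y"
      using open_subgroupsD(2)[OF W] by (simp add: mem_right_coset_iff add_subgroup_zero)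
    ultimately show ?thesis by blast
  qed
  then have "right_coset W ` K \<inter> right_coset W ` L = {}" by blast
  then have "coset_count W (K \<union> L) = coset_count W K + coset_count W L"
    unfolding coset_count_def image_Un
    using KL open_subgroupsD(1)[OF W] by (intro card_Un_disjoint finite_right_cosets)
  then show ?thesis by (simp add: normalized_count_def add_divide_distrib)
qed

lemma haar_content_pos:
  assumes W: "W \<in> open_subgroups"
  shows "haar_content W > 0"
proof -
  have "ennreal (1 / coset_count W V) \<le> ennreal (normalized_count W' W)"
    if W': "W' \<in> open_subgroups" for W'
  proof -
    let ?W = "W \<inter> W'"
    have Int: "?W \<in> open_subgroups" using W W' by (rule open_subgroups_Int)
    have "coset_count ?W V = coset_count W V * coset_count ?W W"
      using W Int by (rule coset_count_V) simp
    then have "1 / coset_count W V = normalized_count ?W W"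
      using coset_count_V_pos[OF Int] by (simp add: normalized_count_def)
    also have "\<dots> \<le> normalized_count W' W"
      using W W' Int by (intro normalized_count_antimono) (auto dest: open_subgroupsD)
    finally show ?thesis by (rule ennreal_leI)
  qed
  then have "ennreal (1 / coset_count W V) \<le> haar_content W"
    unfolding haar_content_def by (rule INF_greatest)
  moreover have "0 < ennreal (1 / coset_count W V)" using coset_count_V_pos[OF W] by simp
  ultimately show ?thesis by (rule less_le_trans[rotated])
qed

end

locale haar_construction = tdlc_group G + compact_open_subgroup V
  for G :: "'g::{topological_group_add, t2_space} itself" and V :: "'g set"
begin

lemma ex_open_subgroups_set_plus_subset:
  assumes "compact K" "open U" "K \<subseteq> U"
  shows "\<exists>W\<in>open_subgroups. W + K \<subseteq> U"
proof -
  obtain W where W: "open_subgroup W" "W + K \<subseteq> U"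
    using ex_open_subgroup_set_plus_subset[OF assms] by blast
  have "W \<inter> V \<in> open_subgroups"
    using W(1) open_subgroup_V by (simp add: open_subgroups_def open_subgroup_Int)
  moreover have "(W \<inter> V) + K \<subseteq> U"
    using W(2) by (meson Int_lower1 order_refl order_trans set_plus_mono2)
  ultimately show ?thesis by blast
qed

lemma haar_content_Un_disjoint_ge:
  assumes KL: "compact K" "compact L" "K \<inter> L = {}"
  shows "haar_content K + haar_content L \<le> haar_content (K \<union> L)"
proof -
  have "open (- L)" "K \<subseteq> - L" using KL by (auto simp: compact_imp_closed open_Compl)
  then obtain W0 where W0: "W0 \<in> open_subgroups" "W0 + K \<subseteq> - L"
    using ex_open_subgroups_set_plus_subset[OF KL(1)] by blast
  show ?thesis
    unfolding haar_content_def[of "K \<union> L"]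
  proof (rule INF_greatest)
    fix W assume W: "W \<in> open_subgroups"
    let ?W = "W \<inter> W0"
    have Int: "?W \<in> open_subgroups" using W W0(1) by (rule open_subgroups_Int)
    have "haar_content K + haar_content L \<le>
        ennreal (normalized_count ?W K) + ennreal (normalized_count ?W L)"
      using Int by (intro add_mono haar_content_le)
    also have "\<dots> = ennreal (normalized_count ?W (K \<union> L))"
    proof -
      have "?W + K \<subseteq> W0 + K" by (intro set_plus_mono2) auto
      then have "(?W + K) \<inter> L = {}" using W0(2) by blast
      then show ?thesis
        by (simp add: normalized_count_Un[OF Int KL(1,2)] normalized_count_nonneg)
    qed
    also have "\<dots> \<le> ennreal (normalized_count W (K \<union> L))"
      using W Int KL by (intro ennreal_leI normalized_count_antimono) auto
    finally show "haar_content K + haar_content L \<le> ennreal (normalized_count W (K \<union> L))" .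
  qed
qed

sublocale compact_content haar_content
proof
  show "haar_content {} = 0"
    using haar_content_le[OF V_in_open_subgroups, of "{}"]
    by (simp add: normalized_count_def coset_count_def)
qed (simp_all add: haar_content_mono haar_content_Un_le haar_content_Un_disjoint_ge)

theorem right_haar_content_measure: "right_haar content_measure"
  unfolding right_haar_iff
proof (intro conjI ballI allI impI)
  show "radon_measure content_measure"
  proof (rule radon_measure_content_measure)
    show "\<exists>U L. open U \<and> compact L \<and> K \<subseteq> U \<and> U \<subseteq> L" if "compact K" for K :: "'g set"
    proof (intro exI conjI)
      show "open (V + K)" "compact (V + K)" "K \<subseteq> V + K"
        using that open_subgroup_V compact_V
        by (simp_all add: open_subgroup_def open_set_plus compact_set_plus subset_set_plus
            add_subgroup_zero)
    qed simp
    show "haar_content K < \<infinity>" for K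
      using haar_content_le[OF V_in_open_subgroups, of K] by (simp add: le_less_trans)
  qed
  show "emeasure content_measure ((\<lambda>x. x + g) ` A) = emeasure content_measure A"
    if "A \<in> sets borel" for A g
    using haar_content_add_right that
    by (rule emeasure_content_measure_homeomorphic_image[OF homeomorphism_add_right])
  show "emeasure content_measure U > 0" if U: "open U \<and> U \<noteq> {}" for U
  proof -
    obtain x where x: "x \<in> U" using U by auto
    then obtain W where W: "W \<in> open_subgroups" "W + {x} \<subseteq> U"
      using U ex_open_subgroups_set_plus_subset[of "{x}" U] by auto
    have eq: "W + {x} = (\<lambda>w. w + x) ` W" by (auto elim!: set_plus_elim)
    have "0 < haar_content (W + {x})"
      unfolding eq haar_content_add_right by (rule haar_content_pos[OF W(1)])
    also have "\<dots> \<le> emeasure content_measure U"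
      using U W
      by (simp add: emeasure_content_measure_open content_le_inner_content compact_set_plus
          open_subgroupsD(4))
    finally show ?thesis .
  qed
qed

end

context tdlc_group
begin

theorem ex_right_haar: "\<exists>M :: 'g measure. right_haar M"
proof -
  obtain V :: "'g set" where "compact V" "open_subgroup V" using van_dantzig[of UNIV] by auto
  then interpret haar_construction G V by unfold_locales
  show ?thesis using right_haar_content_measure by blast
qed

end

section \<open>The modular function\<close>

lemma right_haar_compact_open_pos_finite:
  assumes "right_haar M" "compact C" "open C" "C \<noteq> {}"
  obtains m where "0 < m" "emeasure M C = ennreal m"
proof -
  have "0 < emeasure M C" "emeasure M C < \<infinity>"
    using assms by (auto simp: right_haar_iff radon_measure_compact_finite
      simp del: infinity_ennreal_def)
  then show thesis using that by (cases "emeasure M C") auto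
qed

lemma right_haar_scaling_unique:
  assumes M: "right_haar M" and C: "compact C" "open C" "C \<noteq> {}" and "0 < r" "0 < s"
    and "ennreal r * emeasure M C = ennreal s * emeasure M C"
  shows "r = s"
proof -
  obtain m where "0 < m" "emeasure M C = ennreal m"
    using M C by (rule right_haar_compact_open_pos_finite)
  then show ?thesis using assms by (simp flip: ennreal_mult)
qed

lemma emeasure_right_haar_set_plus:
  assumes M: "right_haar M" and W: "open_subgroup W" and K: "compact K"
  shows "emeasure M (W + K) = of_nat (coset_count W K) * emeasure M W"
proof -
  have W': "open W" "add_subgroup W" using W by (simp_all add: open_subgroup_def)
  have sets: "sets M = sets borel" using M by (simp add: right_haar_iff sets_radon_measure)
  have "disjoint_family_on (\<lambda>c. c) (right_coset W ` K)"
    using right_coset_disjoint[OF W'(2)] unfolding disjoint_family_on_def by blast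
  then have "emeasure M (\<Union>c\<in>right_coset W ` K. c) = (\<Sum>c\<in>right_coset W ` K. emeasure M c)"
    using finite_right_cosets[OF W K] open_right_coset[OF W'(1)]
    by (intro sum_emeasure[symmetric]) (auto simp: sets)
  also have "\<dots> = (\<Sum>c\<in>right_coset W ` K. emeasure M W)"
    using M W'(1) by (intro sum.cong) (auto simp: right_coset_def right_haar_iff)
  finally show ?thesis by (simp add: Union_right_cosets coset_count_def)
qed

lemma emeasure_right_haar_index:
  assumes "right_haar M" "open_subgroup W" "open_subgroup V" "compact V" "W \<subseteq> V"
  shows "emeasure M V = of_nat (coset_count W V) * emeasure M W"
  using emeasure_right_haar_set_plus[OF assms(1,2,4)] set_plus_absorb[of V W] assms
  by (simp add: open_subgroup_def)

lemma emeasure_distr_add_left: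
  fixes M :: "'g::topological_group_add measure"
  assumes "sets M = sets borel" "A \<in> sets borel"
  shows "emeasure (distr M borel (\<lambda>x. - g + x)) A = emeasure M ((\<lambda>x. g + x) ` A)"
  using homeomorphism_add_left assms by (rule emeasure_distr_homeomorphism)

lemma right_haar_distr_add_left:
  fixes M :: "'g::{topological_group_add, t2_space} measure"
  assumes "right_haar M"
  shows "right_haar (distr M borel (\<lambda>x. - g + x))"
proof -
  have M: "radon_measure M" "\<And>A g. A \<in> sets borel \<Longrightarrow> emeasure M ((\<lambda>x. x + g) ` A) = emeasure M A"
    "\<And>U. open U \<Longrightarrow> U \<noteq> {} \<Longrightarrow> emeasure M U > 0"
    using assms by (auto simp: right_haar_iff)
  note distr = emeasure_distr_add_left[OF sets_radon_measure[OF M(1)]]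
  show ?thesis
    unfolding right_haar_iff
  proof (intro conjI ballI allI impI)
    show "radon_measure (distr M borel (\<lambda>x. - g + x))"
      by (rule radon_measure_distr_homeomorphism[OF homeomorphism_add_left M(1)])
    show "emeasure (distr M borel (\<lambda>x. - g + x)) U > 0" if "open U \<and> U \<noteq> {}" for U
      unfolding distr[OF borel_open[OF conjunct1[OF that]]]
      using that by (intro M(3) open_homeomorphic_image[OF homeomorphism_add_left]) auto
    fix A :: "'g set" and h assume A: "A \<in> sets borel"
    have commute: "(\<lambda>x. g + x) ` (\<lambda>x. x + h) ` A = (\<lambda>x. x + h) ` (\<lambda>x. g + x) ` A"
      by (simp add: image_image add.assoc)
    show "emeasure (distr M borel (\<lambda>x. - g + x)) ((\<lambda>x. x + h) ` A) =
        emeasure (distr M borel (\<lambda>x. - g + x)) A"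
      unfolding distr[OF borel_homeomorphic_image[OF homeomorphism_add_right A]] distr[OF A] commute
      by (rule M(2)[OF borel_homeomorphic_image[OF homeomorphism_add_left A]])
  qed
qed

definition haar_measure :: "'g::topological_group_add measure" where
  "haar_measure = (SOME M. right_haar M)"

context tdlc_group
begin

lemma ex_compact_open_between:
  fixes K U :: "'g set"
  assumes "compact K" "open U" "K \<subseteq> U"
  shows "\<exists>C. compact C \<and> open C \<and> K \<subseteq> C \<and> C \<subseteq> U"
proof -
  obtain W where W: "compact W" "open_subgroup W" "W + K \<subseteq> U"
    using ex_open_subgroup_set_plus_subset[OF assms] by blast
  then have "compact (W + K)" "open (W + K)" "K \<subseteq> W + K"
    using assms(1)
    by (simp_all add: open_subgroup_def compact_set_plus open_set_plus subset_set_plus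
        add_subgroup_zero)
  then show ?thesis using W(3) by blast
qed

lemma compact_open_set_plus_invariant:
  fixes C :: "'g set"
  assumes "compact C" "open C"
  obtains W where "open_subgroup W" "W + C = C"
proof -
  obtain W where W: "open_subgroup W" "W + C \<subseteq> C"
    using ex_open_subgroup_set_plus_subset[OF assms] by blast
  moreover have "C \<subseteq> W + C"
    using W(1) by (simp add: open_subgroup_def subset_set_plus add_subgroup_zero)
  ultimately show thesis using that by blast
qed

lemma right_haar_proportional_compact_open:
  fixes C :: "'g set"
  assumes M: "right_haar M" and N: "right_haar N"
    and V: "compact V" "open_subgroup V" and C: "compact C" "open C"
    and scale: "emeasure N V = ennreal r * emeasure M V"
  shows "emeasure N C = ennreal r * emeasure M C"
proof -
  obtain W where W: "open_subgroup W" "W + C = C"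
    using C by (rule compact_open_set_plus_invariant)
  define U where "U = W \<inter> V"
  have U: "open_subgroup U" unfolding U_def by (intro open_subgroup_Int W V)
  have "U + C = C"
  proof (rule antisym)
    show "U + C \<subseteq> C" using set_plus_mono2[of U W C C] W(2) by (simp add: U_def)
    show "C \<subseteq> U + C" using U by (simp add: open_subgroup_def subset_set_plus add_subgroup_zero)
  qed
  then have C_eq: "emeasure L C = of_nat (coset_count U C) * emeasure L U" if "right_haar L" for L
    using emeasure_right_haar_set_plus[OF that U C(1)] by simp
  have V_eq: "emeasure L V = of_nat (coset_count U V) * emeasure L U" if "right_haar L" for L
    using that U V by (intro emeasure_right_haar_index) (auto simp: U_def)
  have "of_nat (coset_count U V) * emeasure N U = of_nat (coset_count U V) * (ennreal r * emeasure M U)"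
    using scale by (simp add: V_eq M N ac_simps)
  moreover have "coset_count U V > 0"
    using V U by (intro coset_count_pos) (auto simp: open_subgroup_def add_subgroup_def)
  ultimately have "emeasure N U = ennreal r * emeasure M U"
    by (simp add: ennreal_mult_cancel_left)
  then show ?thesis by (simp add: C_eq M N ac_simps)
qed

theorem right_haar_proportional:
  assumes M: "right_haar M" and N: "right_haar N"
  shows "\<exists>r>0. \<forall>A::'g set\<in>sets borel. emeasure N A = ennreal r * emeasure M A"
proof -
  obtain V :: "'g set" where V: "compact V" "open_subgroup V" using van_dantzig[of UNIV] by auto
  then have "open V" "V \<noteq> {}" by (auto simp: open_subgroup_def add_subgroup_def)
  then obtain m n where mn: "0 < m" "emeasure M V = ennreal m" "0 < n" "emeasure N V = ennreal n"
    using right_haar_compact_open_pos_finite[OF M V(1)]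
      right_haar_compact_open_pos_finite[OF N V(1)] by metis
  have r: "0 < n / m" "emeasure N V = ennreal (n / m) * emeasure M V"
    using mn by (simp_all flip: ennreal_mult)
  have "emeasure N A = ennreal (n / m) * emeasure M A" if "A \<in> sets borel" for A
  proof (rule radon_measure_proportionalI[OF _ _ r(1)])
    show "radon_measure M" "radon_measure N" using M N by (simp_all add: right_haar_iff)
  qed (use that in \<open>auto intro: ex_compact_open_between
      right_haar_proportional_compact_open[OF M N V _ _ r(2)]\<close>)
  then show ?thesis using r(1) by blast
qed

lemma right_haar_haar_measure: "right_haar (haar_measure :: 'g measure)"
  unfolding haar_measure_def using ex_right_haar by (rule someI_ex)

lemma ex_nonempty_compact_open: "\<exists>C :: 'g set. compact C \<and> open C \<and> C \<noteq> {}"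
  using van_dantzig[of UNIV] by (auto simp: open_subgroup_def add_subgroup_def)

lemma modular_function_pos: "modular_function (g :: 'g) > 0"
  and emeasure_haar_measure_add_left: "A \<in> sets borel \<Longrightarrow>
    emeasure haar_measure ((\<lambda>x. g + x) ` A) = ennreal (modular_function g) * emeasure haar_measure A"
proof -
  let ?scales = "\<lambda>r. r > 0 \<and> (\<forall>A\<in>sets borel. emeasure haar_measure ((\<lambda>x. g + x) ` A) =
    ennreal r * emeasure haar_measure A)"
  note haar = right_haar_haar_measure
  have sets: "sets haar_measure = sets (borel :: 'g measure)"
    using haar by (simp add: right_haar_iff sets_radon_measure)
  obtain r where r: "?scales r"
    using right_haar_proportional[OF haar right_haar_distr_add_left[OF haar, of g]]
    by (auto simp: emeasure_distr_add_left[OF sets])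
  obtain C :: "'g set" where "compact C" "open C" "C \<noteq> {}" using ex_nonempty_compact_open by blast
  then have "s = r" if "?scales s" for s
    using that r by (intro right_haar_scaling_unique[OF haar]) auto
  with r have "\<exists>!r. ?scales r" by blast
  then have "?scales (modular_function g)"
    unfolding modular_function_def haar_measure_def[symmetric] by (rule theI')
  then show "modular_function g > 0" "A \<in> sets borel \<Longrightarrow>
    emeasure haar_measure ((\<lambda>x. g + x) ` A) = ennreal (modular_function g) * emeasure haar_measure A"
    by blast+
qed

lemma modular_function_eqI:
  fixes g :: 'g
  assumes C: "compact C" "open C" "C \<noteq> {}" and "0 < r"
    and "emeasure haar_measure ((\<lambda>x. g + x) ` C) = ennreal r * emeasure haar_measure C"
  shows "modular_function g = r"
  using right_haar_scaling_unique[OF right_haar_haar_measure C modular_function_pos[of g] \<open>0 < r\<close>] assms(5)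
    emeasure_haar_measure_add_left[OF borel_open[OF C(2)], of g] by simp

lemma modular_function_zero: "modular_function (0 :: 'g) = 1"
proof -
  obtain C :: "'g set" where "compact C" "open C" "C \<noteq> {}" using ex_nonempty_compact_open by blast
  then show ?thesis by (rule modular_function_eqI) simp_all
qed

lemma modular_function_add: "modular_function (g + h :: 'g) = modular_function g * modular_function h"
proof -
  obtain C :: "'g set" where C: "compact C" "open C" "C \<noteq> {}"
    using ex_nonempty_compact_open by blast
  then show ?thesis
  proof (rule modular_function_eqI)
    have "(\<lambda>x. g + h + x) ` C = (\<lambda>x. g + x) ` (\<lambda>x. h + x) ` C" by (simp add: image_image add.assoc)
    then show "emeasure haar_measure ((\<lambda>x. g + h + x) ` C) =
        ennreal (modular_function g * modular_function h) * emeasure haar_measure C"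
      using C(2) modular_function_pos[of g] modular_function_pos[of h]
      by (simp add: emeasure_haar_measure_add_left open_homeomorphic_image[OF homeomorphism_add_left]
          ennreal_mult mult.assoc)
  qed (simp add: modular_function_pos)
qed

lemma modular_function_coset_count:
  fixes g :: 'g
  assumes V: "compact V" "open_subgroup V" and V': "V' = (\<lambda>x. g + x + - g) ` V"
    and "open_subgroup V'"
  shows "modular_function g * coset_count (V \<inter> V') V = coset_count (V \<inter> V') V'"
proof -
  let ?W = "V \<inter> V'"
  have open_V: "open V" using V(2) by (simp add: open_subgroup_def)
  have image_eq: "V' = (\<lambda>x. x + - g) ` (\<lambda>x. g + x) ` V" unfolding V' by (simp add: image_image)
  then have "compact V'"
    using compact_homeomorphic_image[OF homeomorphism_add_right]
      compact_homeomorphic_image[OF homeomorphism_add_left] V(1) by metis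
  have W: "open_subgroup ?W" using V(2) assms(4) by (rule open_subgroup_Int)
  have "compact ?W" "open ?W" "?W \<noteq> {}"
    using W compact_Int[OF V(1) \<open>compact V'\<close>] by (auto simp: open_subgroup_def add_subgroup_def)
  then obtain w where w: "0 < w" "emeasure haar_measure ?W = ennreal w"
    by (rule right_haar_compact_open_pos_finite[OF right_haar_haar_measure])
  note index = emeasure_right_haar_index[OF right_haar_haar_measure W]
  have "emeasure haar_measure V' = emeasure haar_measure ((\<lambda>x. g + x) ` V)"
    unfolding image_eq
    using right_haar_haar_measure open_homeomorphic_image[OF homeomorphism_add_left open_V]
    by (simp add: right_haar_iff del: add_uminus_conv_diff)
  also have "\<dots> = ennreal (modular_function g) * emeasure haar_measure V"
    using open_V by (simp add: emeasure_haar_measure_add_left)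
  finally have "ennreal (coset_count ?W V' * w) =
      ennreal (modular_function g * (coset_count ?W V * w))"
    using index[OF assms(4) \<open>compact V'\<close>] index[OF V(2,1)] w modular_function_pos[of g]
    by (simp add: ennreal_mult ennreal_of_nat_eq_real_of_nat)
  then have "coset_count ?W V' * w = modular_function g * (coset_count ?W V * w)"
    using w modular_function_pos[of g] by simp
  then show ?thesis using w by simp
qed

end

section \<open>Subgroups of the positive reals\<close>

lemma mult_subgroup_generated_subset:
  assumes "S \<subseteq> mult_subgroup_generated T"
  shows "mult_subgroup_generated S \<subseteq> mult_subgroup_generated T"
proof
  fix x assume "x \<in> mult_subgroup_generated S"
  then show "x \<in> mult_subgroup_generated T"
    by induction (use assms in \<open>auto intro: msg_one msg_mult msg_inv\<close>)
qed

lemma mult_subgroup_generated_eqI: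
  assumes "S \<subseteq> mult_subgroup_generated T" "T \<subseteq> mult_subgroup_generated S"
  shows "mult_subgroup_generated S = mult_subgroup_generated T"
  using assms by (intro antisym mult_subgroup_generated_subset)

lemma mult_subgroup_generated_trivial:
  assumes "S \<subseteq> {1}"
  shows "mult_subgroup_generated S = {1}"
proof -
  have "y = 1" if "y \<in> mult_subgroup_generated S" for y
    using that by induction (use assms in auto)
  then show ?thesis using msg_one by blast
qed

lemma mult_subgroup_generated_singleton_subset:
  assumes "x \<noteq> 0"
  shows "mult_subgroup_generated {x} \<subseteq> range (\<lambda>n. x powi n)"
proof
  fix y assume "y \<in> mult_subgroup_generated {x}"
  then show "y \<in> range (\<lambda>n. x powi n)"
  proof induction
    case (msg_gen y)
    then have "y = x powi 1" by simp
    then show ?case by (rule range_eqI)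
  next
    case msg_one
    have "1 = x powi 0" by simp
    then show ?case by (rule range_eqI)
  next
    case (msg_mult y z)
    then show ?case using assms by (auto simp flip: power_int_add)
  next
    case (msg_inv y)
    then show ?case by (auto simp flip: power_int_minus)
  qed
qed

lemma image_subgroup_generated:
  fixes f :: "'g::group_add \<Rightarrow> real"
  assumes zero: "f 0 = 1" and add: "\<And>x y. f (x + y) = f x * f y"
  shows "f ` subgroup_generated S = mult_subgroup_generated (f ` S)"
proof -
  have uminus: "f (- x) = inverse (f x)" for x
    using add[of x "- x"] zero by (simp add: inverse_unique)
  have "f x \<in> mult_subgroup_generated (f ` S)" if "x \<in> subgroup_generated S" for x
    using that by induction (auto simp: zero add uminus intro: msg_gen msg_one msg_mult msg_inv)
  moreover have "y \<in> f ` subgroup_generated S" if "y \<in> mult_subgroup_generated (f ` S)" for y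
    using that
  proof induction
    case (msg_gen y)
    then show ?case by (auto intro: sg_gen)
  next
    case msg_one
    show ?case using sg_zero zero by (metis imageI)
  next
    case (msg_mult y z)
    then show ?case by (auto simp flip: add intro: sg_add)
  next
    case (msg_inv y)
    then show ?case by (auto simp flip: uminus intro: sg_uminus)
  qed
  ultimately show ?thesis by blast
qed

definition generating_sums :: "real set \<Rightarrow> nat set" where
  "generating_sums H = {(\<Sum>i<k. p i + q i) | (k::nat) (p::nat \<Rightarrow> nat) (q::nat \<Rightarrow> nat).
     k \<ge> 1 \<and> (\<forall>i<k. p i > 0 \<and> q i > 0) \<and>
     mult_subgroup_generated {real (p i) / real (q i) | i. i < k} = H}"

lemma generating_sumsI:
  assumes "finite I" "I \<noteq> {}" and pos: "\<And>i. i \<in> I \<Longrightarrow> p i > 0 \<and> q i > 0"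
    and gen: "mult_subgroup_generated ((\<lambda>i. real (p i) / real (q i)) ` I) = H"
  shows "(\<Sum>i\<in>I. p i + q i) \<in> generating_sums H"
proof -
  obtain f and k :: nat where f: "bij_betw f {..<k} I"
    using ex_bij_betw_nat_finite[OF \<open>finite I\<close>] unfolding atLeast0LessThan by blast
  then have I: "I = f ` {..<k}" by (simp add: bij_betw_def)
  show ?thesis
    unfolding generating_sums_def
  proof (intro CollectI exI conjI)
    show "(\<Sum>i\<in>I. p i + q i) = (\<Sum>i<k. p (f i) + q (f i))"
      using sum.reindex_bij_betw[OF f, of "\<lambda>i. p i + q i"] by simp
    show "k \<ge> 1" using \<open>I \<noteq> {}\<close> I by (cases k) auto
    show "\<forall>i<k. p (f i) > 0 \<and> q (f i) > 0" using pos I by blast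
    have "{real (p (f i)) / real (q (f i)) | i. i < k} = (\<lambda>i. real (p i) / real (q i)) ` I"
      unfolding I by blast
    then show "mult_subgroup_generated {real (p (f i)) / real (q (f i)) | i. i < k} = H"
      using gen by simp
  qed
qed

lemma coprime_ratio_power_le:
  fixes p q a b m :: nat
  assumes "p > 0" "q > 0" "coprime p q" "a > 0" "b > 0" "m > 0"
    and "real a / real b = (real p / real q) ^ m"
  shows "p \<le> a" "q \<le> b"
proof -
  have "real (a * q ^ m) = real (b * p ^ m)"
    using assms by (simp add: field_simps power_divide)
  then have eq: "a * q ^ m = b * p ^ m" by (simp only: of_nat_eq_iff)
  have "coprime (p ^ m) (q ^ m)" using assms by simp
  moreover have "p ^ m dvd a * q ^ m" "q ^ m dvd b * p ^ m" by (metis dvd_triv_right eq)+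
  ultimately have "p ^ m dvd a" "q ^ m dvd b"
    by (simp_all add: coprime_dvd_mult_left_iff coprime_commute)
  then have "p ^ m \<le> a" "q ^ m \<le> b" using assms by (auto intro: dvd_imp_le)
  moreover have "p \<le> p ^ m" "q \<le> q ^ m" using assms by (auto intro: self_le_power)
  ultimately show "p \<le> a" "q \<le> b" by auto
qed

lemma coprime_ratio_powi_sum_le:
  fixes p q a b :: nat and n :: int
  assumes pq: "p > 0" "q > 0" "coprime p q" and ab: "a > 0" "b > 0"
    and "n \<noteq> 0" and eq: "real a / real b = (real p / real q) powi n"
  shows "p + q \<le> a + b"
proof (cases "n > 0")
  case True
  then have "real a / real b = (real p / real q) ^ nat n" using eq by (simp add: power_int_def)
  then show ?thesis using coprime_ratio_power_le[OF pq ab, of "nat n"] True by simp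
next
  case False
  then have "real a / real b = (real q / real p) ^ nat (- n)" using eq by (simp add: power_int_def)
  then show ?thesis
    using coprime_ratio_power_le[of q p a b "nat (- n)"] pq ab False \<open>n \<noteq> 0\<close>
    by (simp add: coprime_commute)
qed

lemma generating_sums_cyclic_ge:
  fixes p q :: nat
  assumes pq: "p > 0" "q > 0" "coprime p q"
    and "s \<in> generating_sums (mult_subgroup_generated {real p / real q})"
  shows "p + q \<le> s"
proof -
  obtain k :: nat and a b :: "nat \<Rightarrow> nat" where k: "k \<ge> 1" and ab: "\<forall>i<k. a i > 0 \<and> b i > 0"
    and gen: "mult_subgroup_generated {real (a i) / real (b i) | i. i < k} =
      mult_subgroup_generated {real p / real q}"
    and s: "s = (\<Sum>i<k. a i + b i)"
    using assms(4) unfolding generating_sums_def by blast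
  let ?S = "{real (a i) / real (b i) | i. i < k}"
  have "\<exists>i<k. p + q \<le> a i + b i"
  proof (cases "p = q")
    case True
    then have "p = 1" "q = 1" using pq by auto
    moreover have "a 0 > 0" "b 0 > 0" using k ab by auto
    ultimately show ?thesis using k by (intro exI[of _ 0]) auto
  next
    case False
    have "real p / real q \<in> mult_subgroup_generated ?S" unfolding gen by (simp add: msg_gen)
    moreover have "real p / real q \<noteq> 1" using False pq by simp
    ultimately have "\<not> ?S \<subseteq> {1}" using mult_subgroup_generated_trivial by blast
    then obtain i where i: "i < k" "real (a i) / real (b i) \<noteq> 1" by blast
    then have "real (a i) / real (b i) \<in> mult_subgroup_generated ?S" by (blast intro: msg_gen)
    then obtain n where n: "real (a i) / real (b i) = (real p / real q) powi n"
      unfolding gen using mult_subgroup_generated_singleton_subset[of "real p / real q"] pq by auto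
    have "n \<noteq> 0" using i(2) n by auto
    moreover have "a i > 0" "b i > 0" using ab i(1) by auto
    ultimately have "p + q \<le> a i + b i" using n by (intro coprime_ratio_powi_sum_le[OF pq])
    then show ?thesis using i(1) by blast
  qed
  then obtain i where i: "i < k" "p + q \<le> a i + b i" by blast
  note i(2)
  also have "a i + b i \<le> s" unfolding s using i(1) by (intro member_le_sum) auto
  finally show ?thesis .
qed

section \<open>Suborbits of vertex-transitive graphs\<close>

locale additive_action =
  fixes act :: "'g::group_add \<Rightarrow> 'v \<Rightarrow> 'v"
  assumes act_zero [simp]: "act 0 v = v"
    and act_add: "act (g + h) v = act g (act h v)"
begin

lemma act_minus_cancel [simp]: "act (- g) (act g v) = v" "act g (act (- g) v) = v"
  by (simp_all flip: act_add)

lemma act_eq_iff [simp]: "act g u = act g v \<longleftrightarrow> u = v"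
  by (metis act_minus_cancel(1))

definition stab :: "'v \<Rightarrow> 'g set" where
  "stab v = {g. act g v = v}"

definition suborbit :: "'v \<Rightarrow> 'v \<Rightarrow> 'v set" where
  "suborbit v u = (\<lambda>x. act x u) ` stab v"

definition paired_suborbit :: "'v \<Rightarrow> 'v set \<Rightarrow> 'v set" where
  "paired_suborbit v c = {act (- g) v | g. act g v \<in> c}"

lemma add_subgroup_stab: "add_subgroup (stab v)"
  unfolding add_subgroup_def stab_def by (auto simp: act_add) (metis act_minus_cancel(1))

lemma stab_act: "stab (act g v) = (\<lambda>x. g + x + - g) ` stab v"
proof (intro equalityI subsetI)
  fix x assume "x \<in> stab (act g v)"
  then have "- g + x + g \<in> stab v" by (simp add: stab_def act_add)
  moreover have "x = g + (- g + x + g) + - g" by (simp add: add.assoc)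
  ultimately show "x \<in> (\<lambda>x. g + x + - g) ` stab v" by blast
qed (auto simp: stab_def act_add simp del: add_uminus_conv_diff)

lemma suborbit_act: "suborbit (act g v) v = act g ` suborbit v (act (- g) v)"
  by (simp add: suborbit_def stab_act image_image act_add del: add_uminus_conv_diff)

lemma suborbit_self: "u \<in> suborbit v u"
  unfolding suborbit_def stab_def by (intro image_eqI[of _ _ 0]) auto

lemma suborbit_eqI:
  assumes "u' \<in> suborbit v u"
  shows "suborbit v u' = suborbit v u"
proof -
  have subset: "suborbit v b \<subseteq> suborbit v a" if "b \<in> suborbit v a" for a b
    using that add_subgroup_add[OF add_subgroup_stab]
    by (auto simp: suborbit_def simp flip: act_add)
  obtain x where x: "x \<in> stab v" "u' = act x u" using assms by (auto simp: suborbit_def)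
  then have "u = act (- x) u'" by simp
  then have "u \<in> suborbit v u'"
    unfolding suborbit_def using add_subgroup_uminus[OF add_subgroup_stab x(1)] by (rule image_eqI)
  then show ?thesis using subset assms by blast
qed

lemma card_suborbit: "card (suborbit v u) = coset_count (stab v \<inter> stab u) (stab v)"
proof -
  have "suborbit v u = (\<lambda>x. act (- x) u) ` stab v"
    unfolding suborbit_def using add_subgroup_uminus[OF add_subgroup_stab]
    by (auto simp: image_iff) (metis minus_minus)+
  moreover have "card ((\<lambda>x. act (- x) u) ` stab v) = card (right_coset (stab v \<inter> stab u) ` stab v)"
  proof (rule card_image_cong_fibres)
    fix x y assume xy: "x \<in> stab v" "y \<in> stab v"
    have "act (- x) u = act (- y) u \<longleftrightarrow> act (x + - y) u = u"
      by (metis act_add act_minus_cancel)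
    also have "\<dots> \<longleftrightarrow> x - y \<in> stab v \<inter> stab u"
      using add_subgroup_diff[OF add_subgroup_stab xy] by (simp add: stab_def)
    also have "\<dots> \<longleftrightarrow> right_coset (stab v \<inter> stab u) x = right_coset (stab v \<inter> stab u) y"
      by (intro right_coset_eq_iff[symmetric] add_subgroup_Int add_subgroup_stab)
    finally show "act (- x) u = act (- y) u \<longleftrightarrow>
      right_coset (stab v \<inter> stab u) x = right_coset (stab v \<inter> stab u) y" .
  qed
  ultimately show ?thesis by (simp add: coset_count_def)
qed

lemma paired_suborbit_act: "paired_suborbit v (suborbit v (act g v)) = suborbit v (act (- g) v)"
proof (intro equalityI subsetI)
  fix w assume "w \<in> paired_suborbit v (suborbit v (act g v))"
  then obtain h x where hx: "w = act (- h) v" "x \<in> stab v" "act h v = act x (act g v)"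
    by (auto simp: paired_suborbit_def suborbit_def)
  have "- h + x + g \<in> stab v" using hx(3) by (simp add: stab_def act_add flip: hx(3))
  moreover have "w = act (- h + x + g) (act (- g) v)"
    using hx(1,2) by (simp add: stab_def act_add)
  ultimately show "w \<in> suborbit v (act (- g) v)" unfolding suborbit_def by blast
next
  fix w assume "w \<in> suborbit v (act (- g) v)"
  then obtain x where x: "x \<in> stab v" "w = act x (act (- g) v)" by (auto simp: suborbit_def)
  have "act (g + - x) v = act g v"
    using add_subgroup_uminus[OF add_subgroup_stab x(1)]
    by (simp add: stab_def act_add del: add_uminus_conv_diff)
  then have "act (g + - x) v \<in> suborbit v (act g v)" using suborbit_self by metis
  moreover have "w = act (- (g + - x)) v"
    using x(2) by (simp add: act_add minus_add del: add_uminus_conv_diff)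
  ultimately show "w \<in> paired_suborbit v (suborbit v (act g v))"
    unfolding paired_suborbit_def by blast
qed

definition suborbit_ratio :: "'v \<Rightarrow> 'v set \<Rightarrow> real" where
  "suborbit_ratio v c = real (card (paired_suborbit v c)) / real (card c)"

end

locale vertex_transitive_graph = additive_action act
  for act :: "'g::group_add \<Rightarrow> 'v \<Rightarrow> 'v" +
  fixes E :: "'v \<Rightarrow> 'v \<Rightarrow> bool"
  assumes E_sym: "E u v \<Longrightarrow> E v u"
    and E_connected: "(u, v) \<in> {(x, y). E x y}\<^sup>*"
    and E_locally_finite: "finite {w. E v w}"
    and E_act: "E (act g u) (act g v) \<longleftrightarrow> E u v"
    and transitive: "\<exists>g. act g u = v"
begin

definition neighbours :: "'v \<Rightarrow> 'v set" where
  "neighbours v = {w. E v w}"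

definition neighbour_suborbits :: "'v \<Rightarrow> 'v set set" where
  "neighbour_suborbits v = suborbit v ` neighbours v"

lemma finite_neighbours: "finite (neighbours v)"
  by (simp add: neighbours_def E_locally_finite)

lemma neighbours_act: "neighbours (act g v) = act g ` neighbours v"
proof (intro equalityI subsetI)
  fix w assume "w \<in> neighbours (act g v)"
  then have "act (- g) w \<in> neighbours v"
    using E_act[of g v "act (- g) w"] by (simp add: neighbours_def)
  then show "w \<in> act g ` neighbours v" by (intro image_eqI[of _ _ "act (- g) w"]) auto
qed (auto simp: neighbours_def E_act)

lemma card_neighbours_eq: "card (neighbours u) = card (neighbours v)"
proof -
  obtain g where "act g v = u" using transitive by blast
  then show ?thesis using neighbours_act[of g v] by (auto intro: card_image simp: inj_on_def)
qed

lemma subgroup_generated_stab_neighbours: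
  "subgroup_generated (stab v \<union> {g. act g v \<in> neighbours v}) = UNIV"
    (is "subgroup_generated ?S = _")
proof -
  have "\<forall>g. act g v = u \<longrightarrow> g \<in> subgroup_generated ?S" for u
    using E_connected[of v u]
  proof induction
    case base
    then show ?case by (auto simp: stab_def intro: sg_gen)
  next
    case (step u w)
    show ?case
    proof (intro allI impI)
      fix g assume g: "act g v = w"
      obtain h where h: "act h v = u" using transitive by blast
      have "w \<in> neighbours (act h v)" using step.hyps(2) h by (simp add: neighbours_def)
      then have "act (- h + g) v \<in> neighbours v" using g by (auto simp: neighbours_act act_add)
      then have "- h + g \<in> subgroup_generated ?S" by (intro sg_gen) simp
      moreover have "h \<in> subgroup_generated ?S" using step.IH h by blast
      ultimately have "h + (- h + g) \<in> subgroup_generated ?S" by (rule sg_add[rotated])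
      moreover have "h + (- h + g) = g" by (simp flip: add.assoc)
      ultimately show "g \<in> subgroup_generated ?S" by simp
    qed
  qed
  then show ?thesis by blast
qed

lemma neighbour_suborbitsE:
  assumes "c \<in> neighbour_suborbits v"
  obtains g where "c = suborbit v (act g v)" "act g v \<in> neighbours v"
  using assms transitive[of v] unfolding neighbour_suborbits_def by (metis imageE)

lemma suborbit_subset_neighbours:
  assumes "u \<in> neighbours v"
  shows "suborbit v u \<subseteq> neighbours v"
proof
  fix w assume "w \<in> suborbit v u"
  then obtain x where "act x v = v" "w = act x u" by (auto simp: suborbit_def stab_def)
  then show "w \<in> neighbours v" using neighbours_act[of x v] assms by auto
qed

lemma minus_act_in_neighbours:
  assumes "act g v \<in> neighbours v"
  shows "act (- g) v \<in> neighbours v"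
  using assms E_sym E_act[of "- g" "act g v" v] by (simp add: neighbours_def)

lemma paired_suborbit_in_neighbour_suborbits:
  assumes "c \<in> neighbour_suborbits v"
  shows "paired_suborbit v c \<in> neighbour_suborbits v"
  using assms by (rule neighbour_suborbitsE)
    (simp add: paired_suborbit_act neighbour_suborbits_def minus_act_in_neighbours)

lemma paired_suborbit_paired_suborbit:
  assumes "c \<in> neighbour_suborbits v"
  shows "paired_suborbit v (paired_suborbit v c) = c"
  using assms by (rule neighbour_suborbitsE) (simp add: paired_suborbit_act)

lemma finite_neighbour_suborbits: "finite (neighbour_suborbits v)"
  by (simp add: neighbour_suborbits_def finite_neighbours)

lemma finite_neighbour_suborbit: "c \<in> neighbour_suborbits v \<Longrightarrow> finite c"
  unfolding neighbour_suborbits_def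
  using suborbit_subset_neighbours finite_neighbours finite_subset by blast

lemma card_neighbour_suborbit_pos: "c \<in> neighbour_suborbits v \<Longrightarrow> card c > 0"
  by (metis card_gt_0_iff empty_iff finite_neighbour_suborbit imageE neighbour_suborbits_def suborbit_self)

lemma sum_card_neighbour_suborbits: "(\<Sum>c\<in>neighbour_suborbits v. card c) = card (neighbours v)"
proof -
  have "\<Union>(neighbour_suborbits v) = neighbours v"
    unfolding neighbour_suborbits_def using suborbit_subset_neighbours suborbit_self by blast
  moreover have "card (\<Union>(neighbour_suborbits v)) = (\<Sum>c\<in>neighbour_suborbits v. card c)"
  proof (rule card_Union_disjoint)
    show "pairwise disjnt (neighbour_suborbits v)"
      unfolding pairwise_def disjnt_iff neighbour_suborbits_def using suborbit_eqI by blast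
  qed (rule finite_neighbour_suborbit)
  ultimately show ?thesis by simp
qed

text \<open>Suborbits as large as their paired suborbit have ratio 1 and are not needed as generators; of
  every other pair exactly one member is growing.\<close>

definition growing_suborbits :: "'v \<Rightarrow> 'v set set" where
  "growing_suborbits v = {c \<in> neighbour_suborbits v. card c < card (paired_suborbit v c)}"

lemma sum_growing_suborbits_le:
  "(\<Sum>c\<in>growing_suborbits v. card (paired_suborbit v c) + card c) \<le> card (neighbours v)"
proof -
  let ?G = "growing_suborbits v" and ?P = "paired_suborbit v ` growing_suborbits v"
  have subset: "?G \<subseteq> neighbour_suborbits v" "?P \<subseteq> neighbour_suborbits v"
    using paired_suborbit_in_neighbour_suborbits by (auto simp: growing_suborbits_def)
  have finite: "finite ?G" using finite_subset[OF subset(1) finite_neighbour_suborbits] .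
  have inj: "inj_on (paired_suborbit v) ?G"
    using subset(1) by (intro inj_onI) (metis paired_suborbit_paired_suborbit subsetD)
  have disjoint: "?G \<inter> ?P = {}"
    using paired_suborbit_paired_suborbit by (fastforce simp: growing_suborbits_def)
  have "(\<Sum>c\<in>?G. card (paired_suborbit v c) + card c) = (\<Sum>c\<in>?P. card c) + (\<Sum>c\<in>?G. card c)"
    by (simp add: sum.distrib sum.reindex[OF inj])
  also have "\<dots> = (\<Sum>c\<in>?G \<union> ?P. card c)"
    using finite disjoint by (simp add: sum.union_disjoint)
  also have "\<dots> \<le> (\<Sum>c\<in>neighbour_suborbits v. card c)"
    using subset by (intro sum_mono2 finite_neighbour_suborbits) auto
  finally show ?thesis by (simp add: sum_card_neighbour_suborbits)
qed

lemma suborbit_ratio_generated_by_growing: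
  assumes c: "c \<in> neighbour_suborbits v"
  shows "suborbit_ratio v c \<in> mult_subgroup_generated (suborbit_ratio v ` growing_suborbits v)"
proof -
  let ?c' = "paired_suborbit v c"
  have c': "?c' \<in> neighbour_suborbits v" using c by (rule paired_suborbit_in_neighbour_suborbits)
  consider (less) "card c < card ?c'" | (greater) "card ?c' < card c" | (equal) "card ?c' = card c"
    by linarith
  then show ?thesis
  proof cases
    case less
    then show ?thesis using c by (intro msg_gen imageI) (simp add: growing_suborbits_def)
  next
    case greater
    then have "?c' \<in> growing_suborbits v"
      using c c' by (simp add: growing_suborbits_def paired_suborbit_paired_suborbit)
    moreover have "suborbit_ratio v c = inverse (suborbit_ratio v ?c')"
      by (simp add: suborbit_ratio_def paired_suborbit_paired_suborbit[OF c])
    ultimately show ?thesis by (auto intro: msg_inv msg_gen)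
  next
    case equal
    then show ?thesis
      using card_neighbour_suborbit_pos[OF c] by (simp add: suborbit_ratio_def msg_one)
  qed
qed

lemma two_le_card_neighbours:
  assumes "infinite (UNIV :: 'v set)"
  shows "2 \<le> card (neighbours v)"
proof (rule ccontr)
  assume "\<not> 2 \<le> card (neighbours v)"
  then have "card (neighbours u) \<le> Suc 0" for u using card_neighbours_eq[of u v] by simp
  then have unique: "x = y" if "x \<in> neighbours u" "y \<in> neighbours u" for u x y
    using that by (simp add: card_le_Suc0_iff_eq finite_neighbours)
  have "u \<in> insert v (neighbours v)" for u
    using E_connected[of v u]
  proof induction
    case (step x y)
    then show ?case using unique E_sym unfolding neighbours_def by blast
  qed simp
  then show False using assms finite_neighbours[of v] by (metis UNIV_eq_I finite_insert)
qed

end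

section \<open>Cayley--Abels graphs\<close>

locale cayley_abels = tdlc_group "TYPE('g)"
  for act :: "'g::{topological_group_add, t2_space} \<Rightarrow> 'v \<Rightarrow> 'v" and E :: "'v \<Rightarrow> 'v \<Rightarrow> bool" +
  assumes cayley_abels_graph: "cayley_abels_graph act E"
begin

sublocale vertex_transitive_graph act E
  using cayley_abels_graph unfolding cayley_abels_graph_def by unfold_locales blast+

lemma compact_stab: "compact (stab v)"
  and open_subgroup_stab: "open_subgroup (stab v)"
  using cayley_abels_graph add_subgroup_stab
  by (auto simp: cayley_abels_graph_def stab_def open_subgroup_def)

lemma modular_function_eq_suborbit_ratio:
  "modular_function g = suborbit_ratio v (suborbit v (act g v))"
proof -
  let ?u = "act g v"
  have "card (suborbit ?u v) = card (suborbit v (act (- g) v))"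
    unfolding suborbit_act by (intro card_image) (simp add: inj_on_def)
  moreover have "modular_function g * card (suborbit v ?u) = card (suborbit ?u v)"
    unfolding card_suborbit Int_commute[of "stab ?u"]
    by (rule modular_function_coset_count[OF compact_stab open_subgroup_stab stab_act open_subgroup_stab])
  moreover have "card (suborbit v ?u) > 0"
    unfolding card_suborbit using add_subgroup_zero[OF add_subgroup_stab]
    by (intro coset_count_pos open_subgroup_Int open_subgroup_stab compact_stab) auto
  ultimately show ?thesis
    by (simp add: suborbit_ratio_def paired_suborbit_act field_simps)
qed

lemma range_modular_function:
  "range (modular_function :: 'g \<Rightarrow> real) =
     mult_subgroup_generated (suborbit_ratio v ` growing_suborbits v)"
proof -
  let ?moving = "{g. act g v \<in> neighbours v}"
  have "range (modular_function :: 'g \<Rightarrow> real) =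
      mult_subgroup_generated (modular_function ` (stab v \<union> ?moving))"
    using image_subgroup_generated[of modular_function "stab v \<union> ?moving",
      OF modular_function_zero modular_function_add]
    unfolding subgroup_generated_stab_neighbours .
  also have "\<dots> = mult_subgroup_generated (suborbit_ratio v ` growing_suborbits v)"
  proof (intro mult_subgroup_generated_eqI image_subsetI)
    fix g assume "g \<in> stab v \<union> ?moving"
    then show "modular_function g \<in> mult_subgroup_generated (suborbit_ratio v ` growing_suborbits v)"
    proof
      assume "g \<in> stab v"
      then have "act g v = act 0 v" by (simp add: stab_def)
      then have "modular_function g = 1"
        using modular_function_eq_suborbit_ratio[of _ v] modular_function_zero by metis
      then show ?thesis by (simp add: msg_one)
    next
      assume "g \<in> ?moving"
      then show ?thesis
        unfolding modular_function_eq_suborbit_ratio[of g v]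
        by (intro suborbit_ratio_generated_by_growing) (simp add: neighbour_suborbits_def)
    qed
  next
    fix c assume "c \<in> growing_suborbits v"
    then obtain g where "c = suborbit v (act g v)" "g \<in> ?moving"
      by (auto simp: growing_suborbits_def elim: neighbour_suborbitsE)
    then have "suborbit_ratio v c \<in> modular_function ` (stab v \<union> ?moving)"
      using modular_function_eq_suborbit_ratio[of g v] by (intro image_eqI[of _ _ g]) auto
    then show "suborbit_ratio v c \<in> mult_subgroup_generated (modular_function ` (stab v \<union> ?moving))"
      by (rule msg_gen)
  qed
  finally show ?thesis .
qed

lemma infinite_vertices:
  assumes "\<not> compact (UNIV :: 'g set)"
  shows "infinite (UNIV :: 'v set)"
proof
  assume "finite (UNIV :: 'v set)"
  moreover have "compact {g. act g v = u}" for u v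
  proof -
    obtain h where h: "act h v = u" using transitive by blast
    have "{g. act g v = u} = (\<lambda>x. h + x) ` stab v"
    proof (intro equalityI subsetI)
      fix g assume "g \<in> {g. act g v = u}"
      then have "act (- h + g) v = act (- h) (act h v)" by (simp add: act_add h)
      then have "- h + g \<in> stab v" by (simp add: stab_def)
      moreover have "g = h + (- h + g)" by (simp flip: add.assoc)
      ultimately show "g \<in> (\<lambda>x. h + x) ` stab v" by blast
    qed (use h in \<open>auto simp: stab_def act_add\<close>)
    then show ?thesis
      using compact_homeomorphic_image[OF homeomorphism_add_left compact_stab] by simp
  qed
  ultimately have "compact (\<Union>u. {g. act g v = u})" for v by (intro compact_UN) auto
  moreover have "(\<Union>u. {g. act g v = u}) = UNIV" for v by auto
  ultimately show False using assms by simp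
qed

lemma ex_generating_sum_le_degree:
  assumes "\<not> compact (UNIV :: 'g set)"
  shows "\<exists>s\<in>generating_sums (range (modular_function :: 'g \<Rightarrow> real)). s \<le> card (neighbours v)"
proof (cases "growing_suborbits v = {}")
  case True
  then have "(\<Sum>i\<in>{0::nat}. 1 + 1) \<in> generating_sums (range (modular_function :: 'g \<Rightarrow> real))"
    by (intro generating_sumsI)
      (simp_all add: range_modular_function[of v] mult_subgroup_generated_trivial)
  moreover have "(\<Sum>i\<in>{0::nat}. 1 + 1) \<le> card (neighbours v)"
    using two_le_card_neighbours[OF infinite_vertices[OF assms], of v] by simp
  ultimately show ?thesis by blast
next
  case False
  have "(\<Sum>c\<in>growing_suborbits v. card (paired_suborbit v c) + card c)
      \<in> generating_sums (range (modular_function :: 'g \<Rightarrow> real))"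
  proof (rule generating_sumsI[OF _ False])
    show "finite (growing_suborbits v)"
      by (simp add: growing_suborbits_def finite_neighbour_suborbits)
    show "card (paired_suborbit v c) > 0 \<and> card c > 0" if "c \<in> growing_suborbits v" for c
      using that card_neighbour_suborbit_pos by (auto simp: growing_suborbits_def)
    show "mult_subgroup_generated
        ((\<lambda>c. real (card (paired_suborbit v c)) / real (card c)) ` growing_suborbits v) =
        range (modular_function :: 'g \<Rightarrow> real)"
      unfolding range_modular_function[of v] suborbit_ratio_def ..
  qed
  then show ?thesis using sum_growing_suborbits_le by blast
qed

end

theorem theorem4p4:
  fixes act :: "'g::{topological_group_add, t2_space} \<Rightarrow> 'v \<Rightarrow> 'v"
    and E :: "'v \<Rightarrow> 'v \<Rightarrow> bool"
    and H :: "real set" and A :: "nat set"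
  assumes "\<not> compact (UNIV :: 'g set)"
    and "compactly_generated TYPE('g)"
    and "totally_disconnected_space TYPE('g)"
    and "locally_compact_type TYPE('g)"
    and H_def: "H = range (modular_function :: 'g \<Rightarrow> real)"
    and A_def: "A = {(\<Sum>i<k. p i + q i) | (k::nat) (p::nat \<Rightarrow> nat) (q::nat \<Rightarrow> nat). k \<ge> 1 \<and> (\<forall>i<k. p i > 0 \<and> q i > 0) \<and>
                   mult_subgroup_generated {real (p i) / real (q i) | i. i < k} = H}"
    and "cayley_abels_graph act E"
  shows "A \<noteq> {} \<and> (\<forall>v. (LEAST a. a \<in> A) \<le> card {w. E v w})
     \<and> (\<forall>p q :: nat. p > 0 \<and> q > 0 \<and> coprime p q \<and>
           H = mult_subgroup_generated {real p / real q}
           \<longrightarrow> (\<forall>v. p + q \<le> card {w. E v w}))"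
proof -
  interpret cayley_abels act E using assms(3,4,7) by unfold_locales
  have A: "A = generating_sums H" by (simp add: A_def generating_sums_def)
  have ex_le_degree: "\<exists>a\<in>A. a \<le> card {w. E v w}" for v
    using ex_generating_sum_le_degree[OF assms(1), of v] by (simp add: A H_def neighbours_def)
  show ?thesis
  proof (intro conjI allI impI)
    show "A \<noteq> {}" using ex_le_degree by blast
    show "(LEAST a. a \<in> A) \<le> card {w. E v w}" for v
      using ex_le_degree[of v] by (meson Least_le order_trans)
    show "p + q \<le> card {w. E v w}"
      if "p > 0 \<and> q > 0 \<and> coprime p q \<and> H = mult_subgroup_generated {real p / real q}" for p q v
      using ex_le_degree[of v] generating_sums_cyclic_ge[of p q] that by (metis A order_trans)
  qed
qed

end
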